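(* For any positive integers $n,k$ with $n\ge 2k$, $$G_{n-2k,k}=2^{-2k}G_n.$$
   Context: For nonnegative integers $n_1,n_2$ (not both zero), the generalized partition function of the two-component log-gas is $$G_{n_1,n_2}:=\int_{\mathbb{R}^{n_1+n_2}}e^{-\sum_{i=1}^{n_1+n_2}q_i\lambda_i^2/2}\prod_{1\le j<k\le n_1+n_2}|\lambda_j-\lambda_k|^{q_jq_k}\,d\lambda_1\cdots d\lambda_{n_1+n_2},$$ where $q_j=1$ for $1\le j\le n_1$ and $q_j=2$ for $n_1+1\le j\le n_1+n_2$. Also $$G_n:=G_{n,0}=\int_{\mathbb{R}^n}e^{-\sum_{i=1}^n\lambda_i^2/2}\prod_{1\le i<j\le n}|\lambda_i-\lambda_j|\,d\lambda_1\cdots d\lambda_n .$$ *)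

theory Defs
  imports "HOL-Analysis.Analysis"
begin

text \<open>
  \<open>\<real>\<^sup>N\<close> with Lebesgue measure is rendered as the product measure
  \<open>\<Pi>\<^sub>M i\<in>{1..N}. lborel\<close> on (extensional) functions \<open>{1..N} \<rightarrow> real\<close>,
  because the dimension varies within the statement.
\<close>

definition charge :: "nat \<Rightarrow> nat \<Rightarrow> nat" where
  "charge n1 j = (if j \<le> n1 then 1 else 2)"

definition log_gas_weight :: "nat \<Rightarrow> nat \<Rightarrow> (nat \<Rightarrow> real) \<Rightarrow> real" where
  "log_gas_weight n1 n2 x =
     exp (- (\<Sum>i\<in>{1..n1 + n2}. real (charge n1 i) * (x i)\<^sup>2 / 2)) *
     (\<Prod>(j, k)\<in>{(j, k). 1 \<le> j \<and> j < k \<and> k \<le> n1 + n2}.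
        \<bar>x j - x k\<bar> ^ (charge n1 j * charge n1 k))"

definition gen_partition_fun :: "nat \<Rightarrow> nat \<Rightarrow> real" where
  "gen_partition_fun n1 n2 =
     (\<integral>x. log_gas_weight n1 n2 x \<partial>(\<Pi>\<^sub>M i\<in>{1..n1 + n2}. lborel))"

definition partition_fun :: "nat \<Rightarrow> real" where
  "partition_fun n = gen_partition_fun n 0"

lemma partition_fun_eq:
  "partition_fun n =
     (\<integral>x. exp (- (\<Sum>i\<in>{1..n}. (x i)\<^sup>2 / 2)) *
        (\<Prod>(i, j)\<in>{(i, j). 1 \<le> i \<and> i < j \<and> j \<le> n}. \<bar>x i - x j\<bar>)
      \<partial>(\<Pi>\<^sub>M i\<in>{1..n}. lborel))"
proof -
  have "log_gas_weight n 0 x = exp (- (\<Sum>i\<in>{1..n}. (x i)\<^sup>2 / 2)) *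
     (\<Prod>(i, j)\<in>{(i, j). 1 \<le> i \<and> i < j \<and> j \<le> n}. \<bar>x i - x j\<bar>)" for x
  proof -
    have "(\<Sum>i\<in>{1..n}. real (charge n i) * (x i)\<^sup>2 / 2) = (\<Sum>i\<in>{1..n}. (x i)\<^sup>2 / 2)"
      by (rule sum.cong) (auto simp: charge_def)
    moreover have "(\<Prod>(j, k)\<in>{(j, k). 1 \<le> j \<and> j < k \<and> k \<le> n}.
        \<bar>x j - x k\<bar> ^ (charge n j * charge n k)) =
      (\<Prod>(i, j)\<in>{(i, j). 1 \<le> i \<and> i < j \<and> j \<le> n}. \<bar>x i - x j\<bar>)"
      by (rule prod.cong) (auto simp: charge_def)
    ultimately show ?thesis
      by (simp add: log_gas_weight_def)
  qed
  then show ?thesis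
    by (simp add: partition_fun_def gen_partition_fun_def)
qed

end

theory Submission
  imports Defs "HOL-Probability.Distributions" "HOL-Computational_Algebra.Polynomial"
    "HOL-Combinatorics.Permutations"
begin

text \<open>
  The partition functions with different numbers of charge-2 particles are all values of one
  alternating multilinear form,
  \<open>\<Omega>(f\<^sub>1, \<dots>, f\<^sub>n) = \<integral> (\<Prod>i<j. sgn (x\<^sub>j - x\<^sub>i)) f\<^sub>1(x\<^sub>1) \<cdots> f\<^sub>n(x\<^sub>n) dx\<close>, called \<open>sgn_form\<close> below, on functions of the
  shape polynomial times \<open>exp (- x\<^sup>2 / 2)\<close>.

  A charge-2 particle is the limit of two unit charges, so the weight of the mixed gas is a confluent
  Vandermonde determinant times the signs of the differences of the unit charges
  (\<open>confluent_vandermonde\<close>). Expanding the determinant and integrating, the partition function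
  becomes an antisymmetrised sum of \<open>\<Omega>\<close> on the unit charges times one factor \<open>\<integral> f g'\<close> for every
  charge-2 particle.

  Since the derivative of \<open>sgn\<close> is \<open>2 \<delta>\<close>, a derivative among the entries of \<open>\<Omega>\<close> can be integrated by
  parts; this glues its coordinate to that of another entry (\<open>sgn_form_deriv\<close>). After antisymmetrisation
  only the gluing of two derivatives survives, and it produces precisely a factor \<open>\<integral> f g'\<close>. Thus,
  up to the factor \<open>(2k)! / k!\<close>, the mixed gas with \<open>k\<close> particles of charge 2 is the antisymmetrised \<open>\<Omega>\<close>
  with \<open>2k\<close> of its \<open>n\<close> entries differentiated (\<open>mixed_sum_step\<close>).

  Now take as entries the functions \<open>\<phi>\<^sub>j = He\<^sub>j exp (- x\<^sup>2 / 2)\<close>, \<open>j < n\<close>, with the probabilists' Hermite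
  polynomials. Differentiation raises \<open>j\<close> by one, up to sign, so alternation leaves just the
  configuration in which the top \<open>2k\<close> indices are raised: \<open>\<Omega>\<close> on \<open>\<phi>\<^sub>0, \<dots>, \<phi>\<^sub>n\<close> with \<open>\<phi>\<close> of index \<open>n - 2k\<close>
  omitted (\<open>mixed_sum_raising\<close>).

  Finally let \<open>h\<close> be the monic physicists' Hermite polynomial of degree \<open>n\<close>, times \<open>exp (- x\<^sup>2 / 2)\<close>. It is
  orthogonal to all \<open>\<phi>\<^sub>j\<close> with \<open>j < n\<close>, and by contraction \<open>\<Omega>\<close> vanishes when one entry is \<open>h\<close> and
  the \<open>n - 1\<close> others are distinct \<open>\<phi>\<^sub>j\<close> with \<open>j \<le> n\<close> (\<open>sgn_form_hermite_phys_eq_0\<close>). Expanding \<open>h\<close> in the \<open>\<phi>\<^sub>j\<close> shows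
  that omitting the index \<open>n - 2k\<close> instead of \<open>n\<close> multiplies \<open>\<Omega>\<close> by the coefficient
  \<open>n! / ((n - 2k)! k! 4\<^sup>k)\<close> (\<open>sgn_form_skip_hermite\<close>). The factorials cancel against those of the
  antisymmetrisation, and \<open>4\<close> to the power \<open>- k\<close> is left.
\<close>

section \<open>Polynomials times a Gaussian\<close>

definition gauss_poly :: "real poly \<Rightarrow> real \<Rightarrow> real" where
  "gauss_poly p x = poly p x * exp (- x\<^sup>2 / 2)"

text \<open>
  The operator on polynomials that differentiation becomes once the factor \<open>exp (- x\<^sup>2 / 2)\<close> is
  split off.
\<close>

definition gauss_deriv :: "real poly \<Rightarrow> real poly" where
  "gauss_deriv p = pderiv p - [:0, 1:] * p"

definition gauss_inner :: "real poly \<Rightarrow> real poly \<Rightarrow> real" where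
  "gauss_inner p q = (\<integral>x. gauss_poly p x * gauss_poly q x \<partial>lborel)"

lemma gauss_poly_add: "gauss_poly (p + q) x = gauss_poly p x + gauss_poly q x"
  and gauss_poly_minus: "gauss_poly (- p) x = - gauss_poly p x"
  and gauss_poly_smult: "gauss_poly (smult c p) x = c * gauss_poly p x"
  and gauss_poly_sum: "gauss_poly (sum f A) x = (\<Sum>a\<in>A. gauss_poly (f a) x)"
  and gauss_poly_0: "gauss_poly 0 x = 0"
  by (simp_all add: gauss_poly_def algebra_simps poly_sum sum_distrib_right)

lemma continuous_on_gauss_poly [continuous_intros]: "continuous_on A (gauss_poly p)"
  unfolding gauss_poly_def [abs_def] by (intro continuous_intros) auto

lemma measurable_gauss_poly [measurable]: "gauss_poly p \<in> borel_measurable borel"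
  by (intro borel_measurable_continuous_onI continuous_intros)

lemma DERIV_gauss_poly:
  "(gauss_poly p has_field_derivative gauss_poly (gauss_deriv p) x) (at x)"
  unfolding gauss_poly_def [abs_def] gauss_deriv_def
  by (auto intro!: derivative_eq_intros poly_DERIV simp: algebra_simps)

lemma tendsto_power_gauss: "((\<lambda>x::real. x ^ m * exp (- x\<^sup>2 / 2)) \<longlongrightarrow> 0) at_top"
proof (rule Lim_null_comparison)
  show "((\<lambda>x::real. x ^ m / exp x) \<longlongrightarrow> 0) at_top"
    by (rule tendsto_power_div_exp_0)
  show "\<forall>\<^sub>F x::real in at_top. norm (x ^ m * exp (- x\<^sup>2 / 2)) \<le> x ^ m / exp x"
    using eventually_ge_at_top[of 2]
  proof eventually_elim
    case (elim x)
    then have "x * 2 \<le> x * x" by (intro mult_left_mono) auto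
    then have "- x\<^sup>2 / 2 \<le> - x" by (simp add: power2_eq_square)
    then have "exp (- x\<^sup>2 / 2) \<le> exp (- x)" by simp
    then have "x ^ m * exp (- x\<^sup>2 / 2) \<le> x ^ m * exp (- x)"
      using elim by (intro mult_left_mono) auto
    moreover have "x ^ m / exp x = x ^ m * exp (- x)"
      by (simp add: exp_minus divide_inverse)
    moreover have "norm (x ^ m * exp (- x\<^sup>2 / 2)) = x ^ m * exp (- x\<^sup>2 / 2)"
      using elim by (simp add: abs_mult)
    ultimately show ?case by simp
  qed
qed

lemma gauss_poly_conv_sum:
  "gauss_poly p x = (\<Sum>i\<le>degree p. coeff p i * (x ^ i * exp (- x\<^sup>2 / 2)))"
  by (simp add: gauss_poly_def poly_altdef sum_distrib_right mult.assoc)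

lemma tendsto_gauss_poly_at_top: "(gauss_poly p \<longlongrightarrow> 0) at_top"
proof -
  have "((\<lambda>x. \<Sum>i\<le>degree p. coeff p i * (x ^ i * exp (- x\<^sup>2 / 2))) \<longlongrightarrow>
      (\<Sum>i\<le>degree p. coeff p i * 0)) at_top"
    by (intro tendsto_sum tendsto_mult tendsto_const tendsto_power_gauss)
  then show ?thesis unfolding gauss_poly_conv_sum [abs_def] by simp
qed

lemma gauss_poly_reflect: "gauss_poly p (- x) = gauss_poly (pcompose p [:0, -1:]) x"
  by (simp add: gauss_poly_def poly_pcompose)

lemma tendsto_gauss_poly_at_bot: "(gauss_poly p \<longlongrightarrow> 0) at_bot"
  unfolding filterlim_at_bot_mirror
  by (simp add: gauss_poly_reflect tendsto_gauss_poly_at_top)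

lemma integrable_gauss_poly: "integrable lborel (gauss_poly p)"
proof -
  have "integrable lborel (\<lambda>x::real. x ^ i * exp (- x\<^sup>2 / 2))" for i
  proof -
    have "integrable lborel (\<lambda>x. sqrt (2 * pi) * (std_normal_density x * x ^ i))"
      by (intro integrable_mult_right integrable_std_normal_moment)
    then show ?thesis
      by (simp add: std_normal_density_def algebra_simps)
  qed
  then have "integrable lborel (\<lambda>x. \<Sum>i\<le>degree p. coeff p i * (x ^ i * exp (- x\<^sup>2 / 2)))"
    by (intro Bochner_Integration.integrable_sum integrable_mult_right)
  then show ?thesis unfolding gauss_poly_conv_sum [abs_def] .
qed

lemma gauss_poly_bounded: "\<exists>C. \<forall>x. \<bar>gauss_poly p x\<bar> \<le> C"
proof -
  have "\<forall>\<^sub>F x in at_top. dist (gauss_poly p x) 0 < 1"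
    using tendsto_gauss_poly_at_top[of p] by (rule tendstoD) simp
  then obtain b where b: "\<And>x. x \<ge> b \<Longrightarrow> \<bar>gauss_poly p x\<bar> < 1"
    by (auto simp: eventually_at_top_linorder)
  have "\<forall>\<^sub>F x in at_bot. dist (gauss_poly p x) 0 < 1"
    using tendsto_gauss_poly_at_bot[of p] by (rule tendstoD) simp
  then obtain a where a: "\<And>x. x \<le> a \<Longrightarrow> \<bar>gauss_poly p x\<bar> < 1"
    by (auto simp: eventually_at_bot_linorder)
  have "compact (gauss_poly p ` {a..b})"
    by (intro compact_continuous_image continuous_intros) auto
  then obtain B where B: "\<And>x. x \<in> {a..b} \<Longrightarrow> \<bar>gauss_poly p x\<bar> \<le> B"
    using compact_imp_bounded[of "gauss_poly p ` {a..b}"] unfolding bounded_iff by fastforce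
  have "\<bar>gauss_poly p x\<bar> \<le> max B 1" for x
    using a[of x] b[of x] B[of x] by fastforce
  then show ?thesis by blast
qed

lemma integrable_gauss_poly_mult: "integrable lborel (\<lambda>x. gauss_poly p x * gauss_poly q x)"
proof -
  obtain C where C: "\<And>x. \<bar>gauss_poly p x\<bar> \<le> C" using gauss_poly_bounded by blast
  show ?thesis
  proof (rule Bochner_Integration.integrable_bound)
    show "integrable lborel (\<lambda>x. C * gauss_poly q x)"
      by (intro integrable_mult_right integrable_gauss_poly)
    have "\<bar>gauss_poly p x\<bar> * \<bar>gauss_poly q x\<bar> \<le> \<bar>C\<bar> * \<bar>gauss_poly q x\<bar>" for x
      using C[of x] by (intro mult_right_mono) auto
    then show "AE x in lborel. norm (gauss_poly p x * gauss_poly q x) \<le> norm (C * gauss_poly q x)"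
      by (simp add: abs_mult)
  qed measurable
qed

lemma gauss_inner_add_left: "gauss_inner (p + p') q = gauss_inner p q + gauss_inner p' q"
  unfolding gauss_inner_def gauss_poly_add distrib_right
  by (intro Bochner_Integration.integral_add integrable_gauss_poly_mult)

lemma gauss_inner_smult_left: "gauss_inner (smult c p) q = c * gauss_inner p q"
  by (simp add: gauss_inner_def gauss_poly_smult mult.assoc)

lemma gauss_inner_minus_left: "gauss_inner (- p) q = - gauss_inner p q"
  by (simp add: gauss_inner_def gauss_poly_minus)

lemma gauss_inner_0_left: "gauss_inner 0 q = 0"
  by (simp add: gauss_inner_def gauss_poly_0)

lemma gauss_inner_commute: "gauss_inner p q = gauss_inner q p"
  by (simp add: gauss_inner_def mult.commute)

lemma set_integral_gauss_deriv_greaterThan: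
  "(LBINT x:{a<..}. gauss_poly (gauss_deriv p) x) = - gauss_poly p a"
proof -
  have "(LBINT x=ereal a..\<infinity>. gauss_poly (gauss_deriv p) x) = 0 - gauss_poly p a"
  proof (rule interval_integral_FTC_integrable)
    show "(gauss_poly p has_vector_derivative gauss_poly (gauss_deriv p) x) (at x)" for x
      using DERIV_gauss_poly[of p x] by (simp add: has_real_derivative_iff_has_vector_derivative)
    show "isCont (gauss_poly (gauss_deriv p)) x" for x
      using continuous_on_gauss_poly[of UNIV "gauss_deriv p"]
      by (simp add: continuous_on_eq_continuous_at)
    show "set_integrable lborel (einterval (ereal a) \<infinity>) (gauss_poly (gauss_deriv p))"
      unfolding set_integrable_def
      by (intro integrable_mult_indicator integrable_gauss_poly) auto
    show "((gauss_poly p \<circ> real_of_ereal) \<longlongrightarrow> 0) (at_left \<infinity>)"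
      using tendsto_gauss_poly_at_top[of p] by (simp add: ereal_tendsto_simps)
    have "isCont (gauss_poly p) a"
      using continuous_on_gauss_poly[of UNIV p] by (simp add: continuous_on_eq_continuous_at)
    then have "(gauss_poly p \<longlongrightarrow> gauss_poly p a) (at_right a)"
      by (meson filterlim_at_split isCont_def)
    then show "((gauss_poly p \<circ> real_of_ereal) \<longlongrightarrow> gauss_poly p a) (at_right (ereal a))"
      by (simp add: ereal_tendsto_simps)
  qed simp
  moreover have "einterval (ereal a) \<infinity> = {a<..}" by (auto simp: einterval_def)
  ultimately show ?thesis by (simp add: interval_lebesgue_integral_def)
qed

lemma integral_derivative_eq_0:
  fixes f F :: "real \<Rightarrow> real"
  assumes "\<And>x. (F has_field_derivative f x) (at x)" and "continuous_on UNIV f"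
    and "integrable lborel f" and "(F \<longlongrightarrow> 0) at_top" and "(F \<longlongrightarrow> 0) at_bot"
  shows "(\<integral>x. f x \<partial>lborel) = 0"
proof -
  have "(LBINT x=-\<infinity>..\<infinity>. f x) = 0 - 0"
  proof (rule interval_integral_FTC_integrable)
    show "(F has_vector_derivative f x) (at x)" for x
      using assms(1) by (simp add: has_real_derivative_iff_has_vector_derivative)
    show "isCont f x" for x
      using assms(2) by (simp add: continuous_on_eq_continuous_at)
    show "set_integrable lborel (einterval (-\<infinity>) \<infinity>) f"
      unfolding set_integrable_def
      by (intro integrable_mult_indicator assms) auto
    show "((F \<circ> real_of_ereal) \<longlongrightarrow> 0) (at_left \<infinity>)"
      "((F \<circ> real_of_ereal) \<longlongrightarrow> 0) (at_right (-\<infinity>))"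
      using assms(4,5) by (simp_all add: ereal_tendsto_simps)
  qed simp
  then show ?thesis
    by (simp add: interval_lebesgue_integral_def set_lebesgue_integral_def)
qed

lemma integral_gauss_deriv: "(\<integral>x. gauss_poly (gauss_deriv p) x \<partial>lborel) = 0"
  by (rule integral_derivative_eq_0[OF DERIV_gauss_poly continuous_on_gauss_poly
        integrable_gauss_poly tendsto_gauss_poly_at_top tendsto_gauss_poly_at_bot])

lemma gauss_inner_deriv: "gauss_inner (gauss_deriv p) q = - gauss_inner p (gauss_deriv q)"
proof -
  have "(\<integral>x. gauss_poly (gauss_deriv p) x * gauss_poly q x +
      gauss_poly p x * gauss_poly (gauss_deriv q) x \<partial>lborel) = 0"
  proof (rule integral_derivative_eq_0[where F = "\<lambda>x. gauss_poly p x * gauss_poly q x"])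
    show "((\<lambda>x. gauss_poly p x * gauss_poly q x) has_field_derivative
        gauss_poly (gauss_deriv p) x * gauss_poly q x +
        gauss_poly p x * gauss_poly (gauss_deriv q) x) (at x)" for x
      by (auto intro!: derivative_eq_intros DERIV_gauss_poly)
    show "((\<lambda>x. gauss_poly p x * gauss_poly q x) \<longlongrightarrow> 0) at_top"
      using tendsto_mult[OF tendsto_gauss_poly_at_top tendsto_gauss_poly_at_top] by simp
    show "((\<lambda>x. gauss_poly p x * gauss_poly q x) \<longlongrightarrow> 0) at_bot"
      using tendsto_mult[OF tendsto_gauss_poly_at_bot tendsto_gauss_poly_at_bot] by simp
  qed (intro continuous_intros Bochner_Integration.integrable_add integrable_gauss_poly_mult)+
  then show ?thesis
    unfolding gauss_inner_def
    by (subst (asm) Bochner_Integration.integral_add) (auto intro!: integrable_gauss_poly_mult)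
qed

section \<open>The alternating sign form\<close>

text \<open>
  The distributional derivative of \<open>sgn\<close> is \<open>2 \<delta>\<close>. The product over \<open>X\<close> changes sign at each of
  its points \<open>y\<close>, and the remaining factors, evaluated at \<open>y\<close>, give the direction of that jump. The
  Gaussian removes the boundary terms, whatever the parity of the number of points.
\<close>

lemma integral_gauss_deriv_sgn_prod:
  assumes "finite X"
  shows "(\<integral>t. gauss_poly (gauss_deriv p) t * (\<Prod>y\<in>X. sgn (y - t)) \<partial>lborel) =
    2 * (\<Sum>y\<in>X. gauss_poly p y * (\<Prod>z\<in>X - {y}. sgn (z - y)))"
  using assms
proof (induction X rule: finite_linorder_max_induct)
  case empty
  show ?case by (simp add: integral_gauss_deriv)
next
  case (insert b X)
  let ?f = "gauss_poly (gauss_deriv p)"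
  let ?P = "\<lambda>t. \<Prod>y\<in>X. sgn (y - t)"
  have bX: "b \<notin> X" using insert by auto
  have intP: "integrable lborel (\<lambda>t. ?f t * ?P t)"
  proof (rule Bochner_Integration.integrable_bound)
    show "integrable lborel ?f" by (rule integrable_gauss_poly)
    have "\<bar>?P t\<bar> \<le> 1" for t :: real
      by (auto simp: abs_prod abs_sgn_eq intro!: prod_le_1)
    then have "\<bar>?f t\<bar> * \<bar>?P t\<bar> \<le> \<bar>?f t\<bar> * 1" for t
      by (intro mult_left_mono) auto
    then show "AE t in lborel. norm (?f t * ?P t) \<le> norm (?f t)"
      by (simp add: abs_mult)
  qed measurable
  have intI: "integrable lborel (\<lambda>t. indicator {b<..} t * ?f t)"
    using integrable_mult_indicator[OF _ integrable_gauss_poly[of "gauss_deriv p"], of "{b<..}"]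
    by simp
  \<comment> \<open>\<open>b\<close> is the largest point: the factor \<open>sgn (b - t)\<close> only reverses the sign on \<open>t > b\<close>,
      where every other factor is already \<open>- 1\<close>.\<close>
  have "(\<integral>t. ?f t * (\<Prod>y\<in>insert b X. sgn (y - t)) \<partial>lborel) =
      (\<integral>t. ?f t * ?P t - 2 * (-1) ^ card X * (indicator {b<..} t * ?f t) \<partial>lborel)"
  proof (rule integral_cong_AE)
    have "AE t in lborel. t \<noteq> b" by (rule AE_lborel_singleton)
    then show "AE t in lborel. ?f t * (\<Prod>y\<in>insert b X. sgn (y - t)) =
        ?f t * ?P t - 2 * (-1) ^ card X * (indicator {b<..} t * ?f t)"
    proof eventually_elim
      case (elim t)
      show ?case
      proof (cases "t < b")
        case True
        then show ?thesis using insert bX by simp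
      next
        case False
        with elim have t: "t > b" by simp
        have "?P t = (\<Prod>y\<in>X. - 1)"
          using insert t by (intro prod.cong) (auto simp: sgn_if)
        then show ?thesis using insert bX t by (simp add: algebra_simps)
      qed
    qed
  qed measurable
  also have "\<dots> = (\<integral>t. ?f t * ?P t \<partial>lborel) -
      2 * (-1) ^ card X * (\<integral>t. indicator {b<..} t * ?f t \<partial>lborel)"
    using intP intI by (subst Bochner_Integration.integral_diff) auto
  also have "(\<integral>t. indicator {b<..} t * ?f t \<partial>lborel) = - gauss_poly p b"
    using set_integral_gauss_deriv_greaterThan[where a = b and p = p]
    by (simp add: set_lebesgue_integral_def)
  also have "(\<integral>t. ?f t * ?P t \<partial>lborel) =
      2 * (\<Sum>y\<in>X. gauss_poly p y * (\<Prod>z\<in>X - {y}. sgn (z - y)))"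
    by (rule insert.IH)
  also have "(\<Sum>y\<in>X. gauss_poly p y * (\<Prod>z\<in>X - {y}. sgn (z - y))) =
      (\<Sum>y\<in>X. gauss_poly p y * (\<Prod>z\<in>insert b X - {y}. sgn (z - y)))"
  proof (rule sum.cong[OF refl])
    fix y assume y: "y \<in> X"
    then have "insert b X - {y} = insert b (X - {y})" "y < b" using bX insert by auto
    then show "gauss_poly p y * (\<Prod>z\<in>X - {y}. sgn (z - y)) =
        gauss_poly p y * (\<Prod>z\<in>insert b X - {y}. sgn (z - y))"
      using bX insert by simp
  qed
  finally have *: "(\<integral>t. ?f t * (\<Prod>y\<in>insert b X. sgn (y - t)) \<partial>lborel) =
      2 * (\<Sum>y\<in>X. gauss_poly p y * (\<Prod>z\<in>insert b X - {y}. sgn (z - y))) +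
      2 * ((-1) ^ card X * gauss_poly p b)"
    by simp
  have "(\<Prod>z\<in>insert b X - {b}. sgn (z - b)) = (\<Prod>z\<in>X. - 1)"
    using insert bX by (intro prod.cong) (auto simp: sgn_if)
  then have "(\<Prod>z\<in>insert b X - {b}. sgn (z - b)) = (-1) ^ card X" by simp
  then show ?case unfolding * using insert bX by (simp add: algebra_simps)
qed

definition vdm_sgn :: "nat set \<Rightarrow> (nat \<Rightarrow> real) \<Rightarrow> real" where
  "vdm_sgn I x = (\<Prod>j\<in>I. \<Prod>i\<in>{i\<in>I. i < j}. sgn (x j - x i))"

text \<open>
  By de Bruijn's integration formula this is, for \<open>I\<close> of even cardinality, the Pfaffian of the matrix
  of double integrals of \<open>sgn (y - x)\<close> against the functions with indices \<open>i\<close> and \<open>j\<close>. The integral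
  over all coordinates covers odd cardinalities as well, so that both parities share one proof.
\<close>

definition sgn_form :: "nat set \<Rightarrow> (nat \<Rightarrow> real poly) \<Rightarrow> real" where
  "sgn_form I p =
    (\<integral>x. vdm_sgn I x * (\<Prod>i\<in>I. gauss_poly (p i) (x i)) \<partial>(\<Pi>\<^sub>M i\<in>I. lborel))"

lemma product_sigma_finite_lborel: "product_sigma_finite (\<lambda>_. lborel :: real measure)"
  by (simp add: product_sigma_finite_def lborel.sigma_finite_measure_axioms)

lemma vdm_sgn_measurable [measurable]:
  "I \<subseteq> J \<Longrightarrow> vdm_sgn I \<in> borel_measurable (\<Pi>\<^sub>M i\<in>J. lborel)"
  unfolding vdm_sgn_def [abs_def] by measurable auto

lemma abs_vdm_sgn_le_1: "\<bar>vdm_sgn I x\<bar> \<le> 1"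
  unfolding vdm_sgn_def by (auto simp: abs_prod abs_sgn_eq intro!: prod_le_1 prod_nonneg)

lemma vdm_sgn_cong: "(\<And>i. i \<in> I \<Longrightarrow> x i = y i) \<Longrightarrow> vdm_sgn I x = vdm_sgn I y"
  unfolding vdm_sgn_def by (intro prod.cong) auto

lemma vdm_sgn_remove:
  assumes "finite I" "a \<in> I"
  shows "vdm_sgn I x = (-1) ^ card {i\<in>I. i < a} * vdm_sgn (I - {a}) x *
    (\<Prod>i\<in>I - {a}. sgn (x i - x a))"
proof -
  let ?J = "I - {a}"
  have 1: "(\<Prod>i\<in>{i\<in>I. i < j}. sgn (x j - x i)) =
      (if a < j then sgn (x j - x a) else 1) * (\<Prod>i\<in>{i\<in>?J. i < j}. sgn (x j - x i))" for j
  proof (cases "a < j")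
    case True
    then have "{i\<in>I. i < j} = insert a {i\<in>?J. i < j}" using assms by auto
    then show ?thesis using True assms by simp
  next
    case False
    then have "{i\<in>I. i < j} = {i\<in>?J. i < j}" by auto
    then show ?thesis using False by simp
  qed
  have 2: "(\<Prod>i\<in>{i\<in>I. i < a}. sgn (x a - x i)) =
      (-1) ^ card {i\<in>I. i < a} * (\<Prod>i\<in>?J. if a < i then 1 else sgn (x i - x a))"
  proof -
    have "(\<Prod>i\<in>{i\<in>I. i < a}. sgn (x a - x i)) =
        (\<Prod>i\<in>{i\<in>I. i < a}. (-1) * sgn (x i - x a))"
      by (intro prod.cong refl) (simp add: sgn_minus[symmetric] del: sgn_minus)
    also have "\<dots> = (-1) ^ card {i\<in>I. i < a} * (\<Prod>i\<in>{i\<in>I. i < a}. sgn (x i - x a))"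
      by (simp only: prod.distrib prod_constant)
    also have "(\<Prod>i\<in>{i\<in>I. i < a}. sgn (x i - x a)) =
        (\<Prod>i\<in>?J. if a < i then 1 else sgn (x i - x a))"
      using assms by (intro prod.mono_neutral_cong_left) auto
    finally show ?thesis .
  qed
  have "vdm_sgn I x = (\<Prod>i\<in>{i\<in>I. i < a}. sgn (x a - x i)) *
      (\<Prod>j\<in>?J. \<Prod>i\<in>{i\<in>I. i < j}. sgn (x j - x i))"
    unfolding vdm_sgn_def using assms by (subst prod.remove[of I a]) auto
  also have "\<dots> = (-1) ^ card {i\<in>I. i < a} * vdm_sgn ?J x *
      ((\<Prod>i\<in>?J. if a < i then 1 else sgn (x i - x a)) *
       (\<Prod>i\<in>?J. if a < i then sgn (x i - x a) else 1))"
    unfolding 2 unfolding 1 vdm_sgn_def by (simp add: prod.distrib mult_ac)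
  also have "(\<Prod>i\<in>?J. if a < i then 1 else sgn (x i - x a)) *
       (\<Prod>i\<in>?J. if a < i then sgn (x i - x a) else 1) = (\<Prod>i\<in>?J. sgn (x i - x a))"
    by (subst prod.distrib[symmetric], rule prod.cong) simp_all
  finally show ?thesis .
qed

lemma vdm_sgn_eq_0:
  assumes "finite I" "\<not> inj_on x I"
  shows "vdm_sgn I x = 0"
proof -
  obtain i j where "i \<in> I" "j \<in> I" "i \<noteq> j" "x i = x j"
    using assms by (auto simp: inj_on_def)
  then have "(\<Prod>i\<in>I - {j}. sgn (x i - x j)) = 0"
    using assms by (intro prod_zero bexI[of _ i]) auto
  then show ?thesis
    using vdm_sgn_remove[of I j x] assms \<open>j \<in> I\<close> by simp
qed

lemma integrable_bounded_mult_prod: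
  fixes f :: "nat \<Rightarrow> real \<Rightarrow> real"
  assumes "finite I" and "\<And>i. i \<in> I \<Longrightarrow> integrable lborel (f i)"
    and [measurable]: "F \<in> borel_measurable (\<Pi>\<^sub>M i\<in>I. lborel)" and "\<And>x. \<bar>F x\<bar> \<le> 1"
  shows "integrable (\<Pi>\<^sub>M i\<in>I. lborel) (\<lambda>x. F x * (\<Prod>i\<in>I. f i (x i)))"
proof -
  interpret product_sigma_finite "\<lambda>_. lborel :: real measure"
    by (rule product_sigma_finite_lborel)
  have int: "integrable (\<Pi>\<^sub>M i\<in>I. lborel) (\<lambda>x. \<Prod>i\<in>I. f i (x i))"
    using assms by (intro product_integrable_prod) auto
  show ?thesis
  proof (rule Bochner_Integration.integrable_bound[OF int])
    show "(\<lambda>x. F x * (\<Prod>i\<in>I. f i (x i))) \<in> borel_measurable (\<Pi>\<^sub>M i\<in>I. lborel)"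
      using borel_measurable_integrable[OF int] by measurable
    have "\<bar>F x\<bar> * \<bar>\<Prod>i\<in>I. f i (x i)\<bar> \<le> 1 * \<bar>\<Prod>i\<in>I. f i (x i)\<bar>" for x
      using assms by (intro mult_right_mono) auto
    then show "AE x in \<Pi>\<^sub>M i\<in>I. lborel. norm (F x * (\<Prod>i\<in>I. f i (x i))) \<le>
        norm (\<Prod>i\<in>I. f i (x i))"
      by (simp add: abs_mult)
  qed
qed

lemma integrable_sgn_form:
  "finite I \<Longrightarrow>
    integrable (\<Pi>\<^sub>M i\<in>I. lborel) (\<lambda>x. vdm_sgn I x * (\<Prod>i\<in>I. gauss_poly (p i) (x i)))"
  by (intro integrable_bounded_mult_prod integrable_gauss_poly abs_vdm_sgn_le_1) auto

lemma sgn_form_cong: "(\<And>i. i \<in> I \<Longrightarrow> p i = q i) \<Longrightarrow> sgn_form I p = sgn_form I q"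
  unfolding sgn_form_def by (intro Bochner_Integration.integral_cong refl arg_cong2[where f="(*)"] prod.cong) auto

lemma sgn_form_sum:
  assumes "finite I" "a \<in> I"
  shows "sgn_form I (p(a := \<Sum>l\<in>L. smult (c l) (q l))) = (\<Sum>l\<in>L. c l * sgn_form I (p(a := q l)))"
proof -
  have 1: "(\<Prod>i\<in>I. gauss_poly ((p(a := r)) i) (x i)) =
      gauss_poly r (x a) * (\<Prod>i\<in>I - {a}. gauss_poly (p i) (x i))" for r x
    using assms by (subst prod.remove[of I a]) (auto intro!: prod.cong)
  have "sgn_form I (p(a := \<Sum>l\<in>L. smult (c l) (q l))) =
      (\<integral>x. (\<Sum>l\<in>L. c l * (vdm_sgn I x * (\<Prod>i\<in>I. gauss_poly ((p(a := q l)) i) (x i))))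
        \<partial>(\<Pi>\<^sub>M i\<in>I. lborel))"
    unfolding sgn_form_def 1
    by (simp add: gauss_poly_sum gauss_poly_smult sum_distrib_left sum_distrib_right mult_ac)
  also have "\<dots> = (\<Sum>l\<in>L. c l * sgn_form I (p(a := q l)))"
    unfolding sgn_form_def using assms
    by (subst Bochner_Integration.integral_sum)
       (auto intro!: integrable_mult_right integrable_sgn_form)
  finally show ?thesis .
qed

text \<open>
  The term that arises when the coordinate of an entry \<open>h\<close> is glued to the coordinate \<open>j\<close>: the glued
  coordinate separates from all others. The squared signs equal 1 almost everywhere; they cannot be
  cancelled pointwise because \<open>sgn 0 = 0\<close>.
\<close>

lemma sgn_form_remove_pair:
  assumes "finite J" "j \<in> J"
  shows "integrable (\<Pi>\<^sub>M i\<in>J. lborel) (\<lambda>x. vdm_sgn (J - {j}) x * (\<Prod>i\<in>J - {j}. sgn (x i - x j))\<^sup>2 *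
      (gauss_poly h (x j) * (\<Prod>i\<in>J. gauss_poly (p i) (x i))))" (is ?int)
    and "(\<integral>x. vdm_sgn (J - {j}) x * (\<Prod>i\<in>J - {j}. sgn (x i - x j))\<^sup>2 *
      (gauss_poly h (x j) * (\<Prod>i\<in>J. gauss_poly (p i) (x i))) \<partial>(\<Pi>\<^sub>M i\<in>J. lborel)) =
      gauss_inner h (p j) * sgn_form (J - {j}) p" (is ?eq)
proof -
  interpret product_sigma_finite "\<lambda>_. lborel :: real measure"
    by (rule product_sigma_finite_lborel)
  let ?K = "J - {j}"
  let ?f = "\<lambda>i t. if i = j then gauss_poly h t * gauss_poly (p j) t else gauss_poly (p i) t"
  let ?s = "\<lambda>x. \<Prod>i\<in>?K. sgn (x i - x j :: real)"
  let ?F = "\<lambda>x. vdm_sgn ?K x * (?s x)\<^sup>2 * (gauss_poly h (x j) * (\<Prod>i\<in>J. gauss_poly (p i) (x i)))"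
  have J: "J = insert j ?K" using assms by auto
  have F_eq: "?F = (\<lambda>x. (vdm_sgn ?K x * (?s x)\<^sup>2) * (\<Prod>i\<in>J. ?f i (x i)))"
  proof
    fix x
    have "(\<Prod>i\<in>J. ?f i (x i)) = ?f j (x j) * (\<Prod>i\<in>?K. ?f i (x i))"
      using assms by (subst prod.remove[of J j]) auto
    also have "(\<Prod>i\<in>?K. ?f i (x i)) = (\<Prod>i\<in>?K. gauss_poly (p i) (x i))"
      by (intro prod.cong) auto
    also have "?f j (x j) * \<dots> = gauss_poly h (x j) * (\<Prod>i\<in>J. gauss_poly (p i) (x i))"
      using assms by (subst prod.remove[of J j]) auto
    finally show "?F x = (vdm_sgn ?K x * (?s x)\<^sup>2) * (\<Prod>i\<in>J. ?f i (x i))" by simp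
  qed
  show int: ?int
    unfolding F_eq
  proof (rule integrable_bounded_mult_prod)
    show "integrable lborel (?f i)" for i
      by (cases "i = j") (auto intro: integrable_gauss_poly integrable_gauss_poly_mult)
    have component: "(\<lambda>x. x i) \<in> borel_measurable (\<Pi>\<^sub>M i\<in>J. lborel)" if "i \<in> J" for i
      using that by measurable
    have [measurable]: "vdm_sgn ?K \<in> borel_measurable (\<Pi>\<^sub>M i\<in>J. lborel)"
      by (rule vdm_sgn_measurable) auto
    have [measurable]: "?s \<in> borel_measurable (\<Pi>\<^sub>M i\<in>J. lborel)"
    proof (intro borel_measurable_prod)
      fix i assume "i \<in> ?K"
      then show "(\<lambda>x. sgn (x i - x j)) \<in> borel_measurable (\<Pi>\<^sub>M i\<in>J. lborel)"
        using component[of i] component[of j] assms(2) by simp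
    qed
    show "(\<lambda>x. vdm_sgn ?K x * (?s x)\<^sup>2) \<in> borel_measurable (\<Pi>\<^sub>M i\<in>J. lborel)"
      by measurable
    have "\<bar>?s x\<bar> \<le> 1" for x :: "nat \<Rightarrow> real"
      by (auto simp: abs_prod abs_sgn_eq intro!: prod_le_1)
    then have "\<bar>(?s x)\<^sup>2\<bar> \<le> 1" for x :: "nat \<Rightarrow> real"
      by (simp add: abs_square_le_1)
    then show "\<bar>vdm_sgn ?K x * (?s x)\<^sup>2\<bar> \<le> 1" for x
      using abs_vdm_sgn_le_1[of ?K x] unfolding abs_mult by (intro mult_le_one) auto
  qed (use assms in auto)
  have upd: "?F (x(j := t)) = (vdm_sgn ?K x * (\<Prod>i\<in>?K. gauss_poly (p i) (x i))) *
      ((\<Prod>i\<in>?K. sgn (x i - t))\<^sup>2 * (gauss_poly h t * gauss_poly (p j) t))" for x t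
  proof -
    have "vdm_sgn ?K (x(j := t)) = vdm_sgn ?K x" by (rule vdm_sgn_cong) auto
    moreover have "?s (x(j := t)) = (\<Prod>i\<in>?K. sgn (x i - t))" by (intro prod.cong) auto
    moreover have "(\<Prod>i\<in>J. gauss_poly (p i) ((x(j := t)) i)) =
        gauss_poly (p j) t * (\<Prod>i\<in>?K. gauss_poly (p i) (x i))"
      using assms by (subst prod.remove[of J j]) (auto intro!: prod.cong)
    ultimately show ?thesis by (simp add: mult_ac)
  qed
  have inner: "(\<integral>t. (\<Prod>i\<in>?K. sgn (x i - t))\<^sup>2 * (gauss_poly h t * gauss_poly (p j) t) \<partial>lborel) =
      gauss_inner h (p j)" for x :: "nat \<Rightarrow> real"
    unfolding gauss_inner_def
  proof (rule integral_cong_AE)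
    have "AE t in lborel. \<forall>i\<in>?K. t \<noteq> x i"
      using assms by (intro AE_finite_allI AE_lborel_singleton) auto
    then show "AE t in lborel. (\<Prod>i\<in>?K. sgn (x i - t))\<^sup>2 * (gauss_poly h t * gauss_poly (p j) t) =
        gauss_poly h t * gauss_poly (p j) t"
    proof eventually_elim
      case (elim t)
      have "(\<Prod>i\<in>?K. sgn (x i - t))\<^sup>2 = (\<Prod>i\<in>?K. (sgn (x i - t))\<^sup>2)"
        by (simp add: prod_power_distrib)
      also have "\<dots> = (\<Prod>i\<in>?K. 1)"
        using elim by (intro prod.cong) (auto simp: sgn_if)
      finally show ?case by simp
    qed
  qed measurable
  have "integral\<^sup>L (\<Pi>\<^sub>M i\<in>insert j ?K. lborel) ?F =
      (\<integral>x. (\<integral>t. ?F (x(j := t)) \<partial>lborel) \<partial>(\<Pi>\<^sub>M i\<in>?K. lborel))"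
    using int assms by (intro product_integral_insert) (auto simp: insert_absorb)
  then show ?eq
    unfolding J[symmetric] upd integral_mult_right_zero inner by (simp add: sgn_form_def)
qed

text \<open>
  Contraction rule: integrating by parts in the coordinate \<open>a\<close> of a derivative glues this coordinate in
  turn to every other coordinate \<open>j\<close>, at the cost of the overlap integral of the two entries. The signs
  are those of expanding a Pfaffian along row \<open>a\<close>.
\<close>

lemma sgn_form_deriv:
  assumes "finite I" "a \<in> I" "p a = gauss_deriv h"
  shows "sgn_form I p = 2 * (-1) ^ card {i\<in>I. i < a} *
    (\<Sum>j\<in>I - {a}. (-1) ^ card {i\<in>I - {a}. i < j} * gauss_inner h (p j) * sgn_form (I - {a, j}) p)"
proof -
  interpret product_sigma_finite "\<lambda>_. lborel :: real measure"
    by (rule product_sigma_finite_lborel)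
  let ?J = "I - {a}"
  let ?c = "(-1::real) ^ card {i\<in>I. i < a}"
  let ?G = "\<lambda>x. \<Prod>i\<in>?J. gauss_poly (p i) (x i)"
  let ?s = "\<lambda>x j. \<Prod>i\<in>?J - {j}. sgn (x i - x j :: real)"
  have I: "I = insert a ?J" and fin: "finite ?J" using assms by auto
  have upd: "vdm_sgn I (x(a := t)) * (\<Prod>i\<in>I. gauss_poly (p i) ((x(a := t)) i)) =
      ?c * ?G x * vdm_sgn ?J x * (gauss_poly (gauss_deriv h) t * (\<Prod>i\<in>?J. sgn (x i - t)))" for x t
  proof -
    have "vdm_sgn ?J (x(a := t)) = vdm_sgn ?J x" by (rule vdm_sgn_cong) auto
    moreover have "(\<Prod>i\<in>?J. sgn ((x(a := t)) i - t)) = (\<Prod>i\<in>?J. sgn (x i - t))"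
      by (intro prod.cong) auto
    moreover have "(\<Prod>i\<in>I. gauss_poly (p i) ((x(a := t)) i)) =
        gauss_poly (gauss_deriv h) t * ?G x"
      using assms by (subst prod.remove[of I a]) (auto intro!: prod.cong)
    ultimately show ?thesis
      using vdm_sgn_remove[OF assms(1,2), of "x(a := t)"] by (simp add: mult_ac)
  qed
  \<comment> \<open>Carrying along the factor \<open>vdm_sgn ?J x\<close> makes the identity hold at every \<open>x\<close>: where two
      coordinates coincide, and the jump formula does not apply, both sides vanish.\<close>
  have inner: "vdm_sgn ?J x * (\<integral>t. gauss_poly (gauss_deriv h) t * (\<Prod>i\<in>?J. sgn (x i - t)) \<partial>lborel) =
      2 * (\<Sum>j\<in>?J. (-1) ^ card {i\<in>?J. i < j} *
        (vdm_sgn (?J - {j}) x * (?s x j)\<^sup>2 * gauss_poly h (x j)))" for x :: "nat \<Rightarrow> real"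
  proof -
    have *: "(-1) ^ card {i\<in>?J. i < j} * (vdm_sgn (?J - {j}) x * (?s x j)\<^sup>2 * gauss_poly h (x j)) =
        vdm_sgn ?J x * (gauss_poly h (x j) * ?s x j)" if "j \<in> ?J" for j
      using vdm_sgn_remove[OF fin that, of x] by (simp add: power2_eq_square mult_ac)
    have sum_eq: "(\<Sum>j\<in>?J. (-1) ^ card {i\<in>?J. i < j} *
        (vdm_sgn (?J - {j}) x * (?s x j)\<^sup>2 * gauss_poly h (x j))) =
        vdm_sgn ?J x * (\<Sum>j\<in>?J. gauss_poly h (x j) * ?s x j)"
      unfolding sum_distrib_left by (rule sum.cong[OF refl *])
    show ?thesis
    proof (cases "inj_on x ?J")
      case True
      have "(\<integral>t. gauss_poly (gauss_deriv h) t * (\<Prod>i\<in>?J. sgn (x i - t)) \<partial>lborel) =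
          (\<integral>t. gauss_poly (gauss_deriv h) t * (\<Prod>y\<in>x ` ?J. sgn (y - t)) \<partial>lborel)"
        using True by (simp add: prod.reindex)
      also have "\<dots> = 2 * (\<Sum>y\<in>x ` ?J. gauss_poly h y * (\<Prod>z\<in>x ` ?J - {y}. sgn (z - y)))"
        using fin by (intro integral_gauss_deriv_sgn_prod) auto
      also have "(\<Sum>y\<in>x ` ?J. gauss_poly h y * (\<Prod>z\<in>x ` ?J - {y}. sgn (z - y))) =
          (\<Sum>j\<in>?J. gauss_poly h (x j) * ?s x j)"
      proof (subst sum.reindex[OF True], rule sum.cong[OF refl])
        fix j assume j: "j \<in> ?J"
        have "x ` ?J - {x j} = x ` (?J - {j})"
          using True j by (auto simp: inj_on_def)
        moreover have "inj_on x (?J - {j})" using True by (rule inj_on_subset) auto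
        ultimately show "((\<lambda>y. gauss_poly h y * (\<Prod>z\<in>x ` ?J - {y}. sgn (z - y))) \<circ> x) j =
            gauss_poly h (x j) * ?s x j"
          by (simp add: prod.reindex)
      qed
      finally show ?thesis unfolding sum_eq by simp
    next
      case False
      then have "vdm_sgn ?J x = 0" using fin by (intro vdm_sgn_eq_0)
      then show ?thesis unfolding sum_eq by simp
    qed
  qed
  have "sgn_form I p = (\<integral>x. (\<integral>t. vdm_sgn I (x(a := t)) *
      (\<Prod>i\<in>I. gauss_poly (p i) ((x(a := t)) i)) \<partial>lborel) \<partial>(\<Pi>\<^sub>M i\<in>?J. lborel))"
    unfolding sgn_form_def
    using product_integral_insert[OF fin, of a "\<lambda>x. vdm_sgn I x * (\<Prod>i\<in>I. gauss_poly (p i) (x i))"]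
      integrable_sgn_form[OF assms(1), of p]
    by (simp add: insert_absorb[OF assms(2)])
  also have "\<dots> = (\<integral>x. ?c * ?G x * (vdm_sgn ?J x *
      (\<integral>t. gauss_poly (gauss_deriv h) t * (\<Prod>i\<in>?J. sgn (x i - t)) \<partial>lborel)) \<partial>(\<Pi>\<^sub>M i\<in>?J. lborel))"
    unfolding upd integral_mult_right_zero by (simp add: mult.assoc)
  also have "\<dots> = (\<integral>x. 2 * ?c * (\<Sum>j\<in>?J. (-1) ^ card {i\<in>?J. i < j} *
      (vdm_sgn (?J - {j}) x * (?s x j)\<^sup>2 * (gauss_poly h (x j) * ?G x))) \<partial>(\<Pi>\<^sub>M i\<in>?J. lborel))"
    unfolding inner by (simp add: sum_distrib_left mult_ac)
  also have "\<dots> = 2 * ?c * (\<Sum>j\<in>?J. \<integral>x. (-1) ^ card {i\<in>?J. i < j} *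
      (vdm_sgn (?J - {j}) x * (?s x j)\<^sup>2 * (gauss_poly h (x j) * ?G x)) \<partial>(\<Pi>\<^sub>M i\<in>?J. lborel))"
  proof (subst integral_mult_right_zero, rule arg_cong[where f = "(*) (2 * ?c)"], rule Bochner_Integration.integral_sum)
    fix j assume j: "j \<in> ?J"
    show "integrable (\<Pi>\<^sub>M i\<in>?J. lborel) (\<lambda>x. (-1) ^ card {i\<in>?J. i < j} *
        (vdm_sgn (?J - {j}) x * (?s x j)\<^sup>2 * (gauss_poly h (x j) * ?G x)))"
      by (intro integrable_mult_right sgn_form_remove_pair(1) fin j)
  qed
  also have "\<dots> = 2 * ?c * (\<Sum>j\<in>?J. (-1) ^ card {i\<in>?J. i < j} *
      (gauss_inner h (p j) * sgn_form (?J - {j}) p))"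
  proof (rule arg_cong[where f = "(*) (2 * ?c)"], rule sum.cong[OF refl])
    fix j assume j: "j \<in> ?J"
    show "(\<integral>x. (-1) ^ card {i\<in>?J. i < j} * (vdm_sgn (?J - {j}) x * (?s x j)\<^sup>2 *
        (gauss_poly h (x j) * ?G x)) \<partial>(\<Pi>\<^sub>M i\<in>?J. lborel)) =
        (-1) ^ card {i\<in>?J. i < j} * (gauss_inner h (p j) * sgn_form (?J - {j}) p)"
      by (simp only: integral_mult_right_zero sgn_form_remove_pair(2)[OF fin j])
  qed
  also have "\<dots> = 2 * ?c * (\<Sum>j\<in>?J. (-1) ^ card {i\<in>?J. i < j} *
      gauss_inner h (p j) * sgn_form (I - {a, j}) p)"
    by (simp add: mult.assoc Diff_insert2[symmetric])
  finally show ?thesis .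
qed

section \<open>Behaviour under permutations of the coordinates\<close>

lemma distr_PiM_lborel_reindex:
  fixes \<pi> :: "nat \<Rightarrow> nat"
  assumes \<pi>: "bij_betw \<pi> I K" and fin: "finite I"
  shows "distr (\<Pi>\<^sub>M k\<in>K. lborel) (\<Pi>\<^sub>M i\<in>I. lborel) (\<lambda>y. \<lambda>i\<in>I. y (\<pi> i)) =
    (\<Pi>\<^sub>M i\<in>I. lborel :: real measure)"
proof -
  interpret product_sigma_finite "\<lambda>_. lborel :: real measure"
    by (rule product_sigma_finite_lborel)
  have finK: "finite K" using \<pi> fin by (auto simp: bij_betw_def)
  have \<pi>K: "\<pi> i \<in> K" if "i \<in> I" for i using \<pi> that by (auto simp: bij_betw_def)
  have meas: "(\<lambda>y. \<lambda>i\<in>I. y (\<pi> i)) \<in> measurable (\<Pi>\<^sub>M k\<in>K. lborel :: real measure) (\<Pi>\<^sub>M i\<in>I. lborel)"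
    using \<pi>K by (intro measurable_restrict measurable_component_singleton) auto
  show ?thesis
  proof (rule PiM_eqI)
    fix A :: "nat \<Rightarrow> real set" assume A: "\<And>i. i \<in> I \<Longrightarrow> A i \<in> sets lborel"
    let ?\<rho> = "inv_into I \<pi>"
    have \<rho>: "?\<rho> k \<in> I" "\<pi> (?\<rho> k) = k" if "k \<in> K" for k
      using \<pi> that by (auto simp: bij_betw_def inv_into_into f_inv_into_f)
    have \<rho>\<pi>: "?\<rho> (\<pi> i) = i" if "i \<in> I" for i
      using \<pi> that by (auto simp: bij_betw_def)
    have "(\<lambda>y. \<lambda>i\<in>I. y (\<pi> i)) -` (Pi\<^sub>E I A) \<inter> space (\<Pi>\<^sub>M k\<in>K. lborel) =
        Pi\<^sub>E K (\<lambda>k. A (?\<rho> k))"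
    proof (intro set_eqI iffI)
      fix y assume y: "y \<in> (\<lambda>y. \<lambda>i\<in>I. y (\<pi> i)) -` (Pi\<^sub>E I A) \<inter> space (\<Pi>\<^sub>M k\<in>K. lborel)"
      have "y k \<in> A (?\<rho> k)" if "k \<in> K" for k
        using y \<rho>[OF that] by (auto simp: PiE_iff Pi_iff split: if_splits)
      then show "y \<in> Pi\<^sub>E K (\<lambda>k. A (?\<rho> k))"
        using y by (auto simp: space_PiM PiE_iff)
    next
      fix y assume y: "y \<in> Pi\<^sub>E K (\<lambda>k. A (?\<rho> k))"
      have "y (\<pi> i) \<in> A i" if "i \<in> I" for i
        using y \<pi>K[OF that] \<rho>\<pi>[OF that] by (auto simp: PiE_iff)
      then show "y \<in> (\<lambda>y. \<lambda>i\<in>I. y (\<pi> i)) -` (Pi\<^sub>E I A) \<inter> space (\<Pi>\<^sub>M k\<in>K. lborel)"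
        using y by (auto simp: space_PiM PiE_iff)
    qed
    then have "emeasure (distr (\<Pi>\<^sub>M k\<in>K. lborel) (\<Pi>\<^sub>M i\<in>I. lborel) (\<lambda>y. \<lambda>i\<in>I. y (\<pi> i))) (Pi\<^sub>E I A) =
        emeasure (\<Pi>\<^sub>M k\<in>K. lborel) (Pi\<^sub>E K (\<lambda>k. A (?\<rho> k)))"
      using A fin by (subst emeasure_distr[OF meas]) (auto intro!: sets_PiM_I_finite)
    also have "\<dots> = (\<Prod>k\<in>K. emeasure lborel (A (?\<rho> k)))"
      using A \<rho> by (intro emeasure_PiM finK) auto
    also have "\<dots> = (\<Prod>i\<in>I. emeasure lborel (A (?\<rho> (\<pi> i))))"
      by (rule prod.reindex_bij_betw[OF \<pi>, symmetric])
    also have "\<dots> = (\<Prod>i\<in>I. emeasure lborel (A i))"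
      using \<rho>\<pi> by (intro prod.cong) auto
    finally show "emeasure (distr (\<Pi>\<^sub>M k\<in>K. lborel) (\<Pi>\<^sub>M i\<in>I. lborel) (\<lambda>y. \<lambda>i\<in>I. y (\<pi> i)))
        (Pi\<^sub>E I A) = (\<Prod>i\<in>I. emeasure lborel (A i))" .
  qed (use fin in auto)
qed

text \<open>
  The constant \<open>c\<close> is \<open>1\<close> for an increasing \<open>\<pi>\<close> and the sign of \<open>\<pi>\<close> for a permutation.
\<close>

lemma sgn_form_reindex:
  assumes \<pi>: "bij_betw \<pi> I K" and fin: "finite I"
    and c: "\<And>y. vdm_sgn I (\<lambda>i. y (\<pi> i)) = c * vdm_sgn K y"
  shows "sgn_form I (\<lambda>i. p (\<pi> i)) = c * sgn_form K p"
proof -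
  have \<pi>K: "\<pi> i \<in> K" if "i \<in> I" for i using \<pi> that by (auto simp: bij_betw_def)
  have meas: "(\<lambda>y. \<lambda>i\<in>I. y (\<pi> i)) \<in> measurable (\<Pi>\<^sub>M k\<in>K. lborel :: real measure) (\<Pi>\<^sub>M i\<in>I. lborel)"
    using \<pi>K by (intro measurable_restrict measurable_component_singleton) auto
  let ?f = "\<lambda>x. vdm_sgn I x * (\<Prod>i\<in>I. gauss_poly (p (\<pi> i)) (x i))"
  have "sgn_form I (\<lambda>i. p (\<pi> i)) =
      integral\<^sup>L (distr (\<Pi>\<^sub>M k\<in>K. lborel) (\<Pi>\<^sub>M i\<in>I. lborel) (\<lambda>y. \<lambda>i\<in>I. y (\<pi> i))) ?f"
    unfolding sgn_form_def distr_PiM_lborel_reindex[OF \<pi> fin] ..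
  also have "\<dots> = (\<integral>y. ?f (\<lambda>i\<in>I. y (\<pi> i)) \<partial>(\<Pi>\<^sub>M k\<in>K. lborel))"
    using fin by (intro integral_distr meas borel_measurable_integrable integrable_sgn_form)
  also have "\<dots> = (\<integral>y. c * (vdm_sgn K y * (\<Prod>k\<in>K. gauss_poly (p k) (y k))) \<partial>(\<Pi>\<^sub>M k\<in>K. lborel))"
  proof (rule Bochner_Integration.integral_cong[OF refl])
    fix y
    have "vdm_sgn I (\<lambda>i\<in>I. y (\<pi> i)) = c * vdm_sgn K y"
      unfolding c[symmetric] by (rule vdm_sgn_cong) auto
    moreover have "(\<Prod>i\<in>I. gauss_poly (p (\<pi> i)) ((\<lambda>i\<in>I. y (\<pi> i)) i)) =
        (\<Prod>i\<in>I. gauss_poly (p (\<pi> i)) (y (\<pi> i)))"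
      by (intro prod.cong) auto
    moreover have "\<dots> = (\<Prod>k\<in>K. gauss_poly (p k) (y k))"
      by (rule prod.reindex_bij_betw[OF \<pi>])
    ultimately show "?f (\<lambda>i\<in>I. y (\<pi> i)) = c * (vdm_sgn K y * (\<Prod>k\<in>K. gauss_poly (p k) (y k)))"
      by simp
  qed
  also have "\<dots> = c * sgn_form K p"
    by (simp add: sgn_form_def)
  finally show ?thesis .
qed

lemma sgn_form_reindex_mono:
  fixes \<pi> :: "nat \<Rightarrow> nat"
  assumes mono: "strict_mono_on I \<pi>" and fin: "finite I"
  shows "sgn_form I (\<lambda>i. p (\<pi> i)) = sgn_form (\<pi> ` I) p"
proof -
  have bij: "bij_betw \<pi> I (\<pi> ` I)"
    using mono by (simp add: bij_betw_def strict_mono_on_imp_inj_on)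
  have "vdm_sgn I (\<lambda>i. y (\<pi> i)) = 1 * vdm_sgn (\<pi> ` I) y" for y
  proof -
    have "vdm_sgn (\<pi> ` I) y =
        (\<Prod>j\<in>I. \<Prod>k\<in>{k\<in>\<pi> ` I. k < \<pi> j}. sgn (y (\<pi> j) - y k))"
      unfolding vdm_sgn_def by (rule prod.reindex_bij_betw[OF bij, symmetric])
    also have "\<dots> = vdm_sgn I (\<lambda>i. y (\<pi> i))"
      unfolding vdm_sgn_def
    proof (rule prod.cong[OF refl])
      fix j assume j: "j \<in> I"
      have "bij_betw \<pi> {i\<in>I. i < j} {k\<in>\<pi> ` I. k < \<pi> j}"
        unfolding bij_betw_def
      proof
        show "inj_on \<pi> {i\<in>I. i < j}"
          using bij by (auto simp: bij_betw_def intro: inj_on_subset)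
        show "\<pi> ` {i\<in>I. i < j} = {k\<in>\<pi> ` I. k < \<pi> j}"
          using mono j by (auto simp: strict_mono_on_less)
      qed
      then show "(\<Prod>k\<in>{k\<in>\<pi> ` I. k < \<pi> j}. sgn (y (\<pi> j) - y k)) =
          (\<Prod>i\<in>{i\<in>I. i < j}. sgn (y (\<pi> j) - y (\<pi> i)))"
        by (rule prod.reindex_bij_betw[symmetric])
    qed
    finally show ?thesis by simp
  qed
  from sgn_form_reindex[OF bij fin this] show ?thesis by simp
qed

text \<open>
  Composition with a transposition pairs the terms of the antisymmetrisation with opposite signs.
\<close>

lemma sum_permutes_swap_eq_0:
  fixes T :: "(nat \<Rightarrow> nat) \<Rightarrow> real"
  assumes fin: "finite S" and ab: "a \<in> S" "b \<in> S" "a \<noteq> b"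
    and T: "\<And>\<sigma>. \<sigma> permutes S \<Longrightarrow> T (\<sigma> \<circ> Transposition.transpose a b) = T \<sigma>"
  shows "(\<Sum>\<sigma> | \<sigma> permutes S. of_int (sign \<sigma>) * T \<sigma>) = 0"
proof -
  let ?\<tau> = "Transposition.transpose a b"
  have \<tau>: "?\<tau> permutes S" using ab by (simp add: permutes_swap_id)
  have "(\<Sum>\<sigma> | \<sigma> permutes S. of_int (sign \<sigma>) * T \<sigma>) =
      (\<Sum>\<sigma> | \<sigma> permutes S. of_int (sign (\<sigma> \<circ> ?\<tau>)) * T (\<sigma> \<circ> ?\<tau>))"
    by (rule sum_permutations_compose_right[OF \<tau>])
  also have "\<dots> = (\<Sum>\<sigma> | \<sigma> permutes S. - (of_int (sign \<sigma>) * T \<sigma>))"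
  proof (rule sum.cong[OF refl])
    fix \<sigma> assume "\<sigma> \<in> {\<sigma>. \<sigma> permutes S}"
    then have \<sigma>: "\<sigma> permutes S" by simp
    have "sign (\<sigma> \<circ> ?\<tau>) = - sign \<sigma>"
      using \<sigma> \<tau> fin ab by (simp add: sign_compose permutes_imp_permutation sign_swap_id)
    then show "of_int (sign (\<sigma> \<circ> ?\<tau>)) * T (\<sigma> \<circ> ?\<tau>) = - (of_int (sign \<sigma>) * T \<sigma>)"
      using T[OF \<sigma>] by simp
  qed
  finally show ?thesis by (simp add: sum_negf)
qed

definition alternant :: "(nat \<Rightarrow> real poly) \<Rightarrow> nat \<Rightarrow> (nat \<Rightarrow> real) \<Rightarrow> real" where
  "alternant q n x = (\<Sum>\<sigma> | \<sigma> permutes {1..n}. of_int (sign \<sigma>) * (\<Prod>i\<in>{1..n}. poly (q (\<sigma> i)) (x i)))"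

lemma alternant_eq_0:
  assumes ab: "a \<in> {1..n}" "b \<in> {1..n}" "a \<noteq> b" "x a = x b"
  shows "alternant q n x = 0"
  unfolding alternant_def
proof (rule sum_permutes_swap_eq_0)
  fix \<sigma> assume "\<sigma> permutes {1..n}"
  let ?\<tau> = "Transposition.transpose a b"
  have \<tau>: "bij_betw ?\<tau> {1..n} {1..n}"
    using ab by (intro permutes_imp_bij permutes_swap_id)
  have x: "x (?\<tau> i) = x i" for i
    using ab by (auto simp: Transposition.transpose_def)
  have "(\<Prod>i\<in>{1..n}. poly (q (\<sigma> (?\<tau> i))) (x (?\<tau> i))) = (\<Prod>i\<in>{1..n}. poly (q (\<sigma> i)) (x i))"
    by (rule prod.reindex_bij_betw[OF \<tau>])
  then show "(\<Prod>i\<in>{1..n}. poly (q ((\<sigma> \<circ> ?\<tau>) i)) (x i)) = (\<Prod>i\<in>{1..n}. poly (q (\<sigma> i)) (x i))"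
    by (simp add: x)
qed (use ab in auto)

text \<open>
  As a polynomial in the last variable the alternant has degree at most \<open>n\<close>, vanishes at the \<open>n\<close> other
  points, and has the smaller alternant as leading coefficient, because only permutations fixing the
  last index reach the top degree.
\<close>

lemma alternant_vandermonde:
  assumes monic: "\<And>i. i \<ge> 1 \<Longrightarrow> degree (q i) = i - 1 \<and> lead_coeff (q i) = 1"
  shows "alternant q n x = (\<Prod>j\<in>{1..n}. \<Prod>i\<in>{1..<j}. x j - x i)"
proof (induction n arbitrary: x)
  case 0
  show ?case by (simp add: alternant_def permutes_empty)
next
  case (Suc n)
  let ?N = "Suc n"
  let ?w = "\<lambda>\<sigma>. of_int (sign \<sigma>) * (\<Prod>i\<in>{1..n}. poly (q (\<sigma> i)) (x i))"
  define P where "P = (\<Sum>\<sigma> | \<sigma> permutes {1..?N}. smult (?w \<sigma>) (q (\<sigma> ?N)))"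
  have poly_P: "poly P t = alternant q ?N (x(?N := t))" for t
    unfolding P_def poly_sum alternant_def
    by (intro sum.cong refl) (auto simp: mult.assoc intro!: prod.cong)
  have range: "\<sigma> ?N \<in> {1..?N}" if "\<sigma> permutes {1..?N}" for \<sigma>
    using that permutes_in_image[OF that, of ?N] by simp
  have deg_P: "degree P \<le> n"
    unfolding P_def
  proof (rule degree_sum_le)
    fix \<sigma> assume "\<sigma> \<in> {\<sigma>. \<sigma> permutes {1..?N}}"
    then have "\<sigma> ?N \<in> {1..?N}" using range by auto
    then have "degree (q (\<sigma> ?N)) \<le> n" using monic[of "\<sigma> ?N"] by auto
    then show "degree (smult (?w \<sigma>) (q (\<sigma> ?N))) \<le> n"
      by (meson degree_smult_le le_trans)
  qed (simp add: finite_permutations)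
  have coeff_P: "coeff P n = alternant q n x"
  proof -
    have "coeff P n = (\<Sum>\<sigma> | \<sigma> permutes {1..?N}. ?w \<sigma> * coeff (q (\<sigma> ?N)) n)"
      by (simp add: P_def coeff_sum)
    also have "\<dots> = (\<Sum>\<sigma> | \<sigma> permutes {1..n}. ?w \<sigma>)"
    proof (rule sum.mono_neutral_cong_right)
      show "{\<sigma>. \<sigma> permutes {1..n}} \<subseteq> {\<sigma>. \<sigma> permutes {1..?N}}"
      proof (rule Collect_mono, rule impI)
        fix \<sigma> :: "nat \<Rightarrow> nat" assume "\<sigma> permutes {1..n}"
        then show "\<sigma> permutes {1..?N}" by (rule permutes_subset) simp
      qed
      show "\<forall>\<sigma>\<in>{\<sigma>. \<sigma> permutes {1..?N}} - {\<sigma>. \<sigma> permutes {1..n}}. ?w \<sigma> * coeff (q (\<sigma> ?N)) n = 0"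
      proof
        fix \<sigma> assume \<sigma>: "\<sigma> \<in> {\<sigma>. \<sigma> permutes {1..?N}} - {\<sigma>. \<sigma> permutes {1..n}}"
        have "\<sigma> ?N \<noteq> ?N"
        proof
          assume "\<sigma> ?N = ?N"
          with \<sigma> show False
            using permutes_superset[of \<sigma> "{1..?N}" "{1..n}"] by (auto simp: le_Suc_eq)
        qed
        then have "degree (q (\<sigma> ?N)) < n"
          using range[of \<sigma>] \<sigma> monic[of "\<sigma> ?N"] by auto
        then show "?w \<sigma> * coeff (q (\<sigma> ?N)) n = 0" by (simp add: coeff_eq_0)
      qed
      fix \<sigma> assume "\<sigma> \<in> {\<sigma>. \<sigma> permutes {1..n}}"
      then have "\<sigma> ?N = ?N" by (auto simp: permutes_def)
      moreover have "coeff (q ?N) n = 1" using monic[of ?N] by auto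
      ultimately show "?w \<sigma> * coeff (q (\<sigma> ?N)) n = ?w \<sigma>" by simp
    qed (simp add: finite_permutations)
    finally show ?thesis by (simp add: alternant_def)
  qed
  have "alternant q ?N x = alternant q n x * (\<Prod>i\<in>{1..n}. x ?N - x i)"
  proof (cases "inj_on x {1..n}")
    case True
    have "P = smult (alternant q n x) (\<Prod>i\<in>{1..n}. [:- x i, 1:])"
    proof (rule poly_eqI_degree_lead_coeff)
      have deg: "degree (\<Prod>i\<in>{1..n}. [:- x i, 1:]) = n"
        by (subst degree_prod_eq_sum_degree) auto
      then have "coeff (\<Prod>i\<in>{1..n}. [:- x i, 1:]) n = 1"
        using lead_coeff_prod[of "\<lambda>i. [:- x i, 1:]" "{1..n}"] by simp
      then show "coeff P n = coeff (smult (alternant q n x) (\<Prod>i\<in>{1..n}. [:- x i, 1:])) n"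
        by (simp add: coeff_P)
      show "degree (smult (alternant q n x) (\<Prod>i\<in>{1..n}. [:- x i, 1:])) \<le> n"
        using deg degree_smult_le by metis
      show "degree P \<le> n" by (rule deg_P)
      show "n \<le> card (x ` {1..n})" using True by (simp add: card_image)
      fix z assume "z \<in> x ` {1..n}"
      then obtain a where a: "a \<in> {1..n}" "z = x a" by auto
      have "poly P z = 0"
        unfolding poly_P using a by (intro alternant_eq_0[of a _ ?N]) auto
      moreover have "(\<Prod>i\<in>{1..n}. z - x i) = 0"
        using a by (intro prod_zero) auto
      ultimately show "poly P z = poly (smult (alternant q n x) (\<Prod>i\<in>{1..n}. [:- x i, 1:])) z"
        by (simp add: poly_prod)
    qed
    then have "poly P (x ?N) = alternant q n x * (\<Prod>i\<in>{1..n}. x ?N - x i)"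
      by (simp add: poly_prod)
    then show ?thesis unfolding poly_P by simp
  next
    case False
    then obtain a b where ab: "a \<in> {1..n}" "b \<in> {1..n}" "a \<noteq> b" "x a = x b"
      by (auto simp: inj_on_def)
    then have "alternant q n x = 0" by (rule alternant_eq_0)
    moreover have "alternant q ?N x = 0"
      using ab by (intro alternant_eq_0[of a _ b]) auto
    ultimately show ?thesis by simp
  qed
  then show ?case
    using Suc.IH by (simp add: atLeastLessThanSuc_atLeastAtMost)
qed

lemma sgn_prod: "sgn (prod f A) = (\<Prod>a\<in>A. sgn (f a :: real))"
  by (induction A rule: infinite_finite_induct) (auto simp: sgn_mult)

lemma vdm_sgn_eq_sgn_alternant: "vdm_sgn {1..n} x = sgn (alternant (\<lambda>i. monom 1 (i - 1)) n x)"
proof -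
  have "vdm_sgn {1..n} x = (\<Prod>j\<in>{1..n}. \<Prod>i\<in>{1..<j}. sgn (x j - x i))"
    unfolding vdm_sgn_def by (intro prod.cong) auto
  then show ?thesis
    by (subst alternant_vandermonde) (auto simp: degree_monom_eq sgn_prod)
qed

text \<open>
  The alternant, whose sign \<open>vdm_sgn\<close> is, is visibly alternating in its variables.
\<close>

lemma vdm_sgn_permute:
  assumes \<tau>: "\<tau> permutes {1..n}"
  shows "vdm_sgn {1..n} (\<lambda>i. x (\<tau> i)) = of_int (sign \<tau>) * vdm_sgn {1..n} x"
proof -
  let ?q = "\<lambda>i. monom (1::real) (i - 1)"
  have perm: "permutation \<sigma>" if "\<sigma> permutes {1..n}" for \<sigma>
    using that by (rule permutes_imp_permutation[rotated]) simp
  have "alternant ?q n (\<lambda>i. x (\<tau> i)) =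
      (\<Sum>\<sigma> | \<sigma> permutes {1..n}. of_int (sign (\<sigma> \<circ> \<tau>)) * (\<Prod>i\<in>{1..n}. poly (?q ((\<sigma> \<circ> \<tau>) i)) (x (\<tau> i))))"
    unfolding alternant_def by (rule sum_permutations_compose_right[OF \<tau>])
  also have "\<dots> = (\<Sum>\<sigma> | \<sigma> permutes {1..n}. of_int (sign \<tau>) *
      (of_int (sign \<sigma>) * (\<Prod>i\<in>{1..n}. poly (?q (\<sigma> i)) (x i))))"
  proof (rule sum.cong[OF refl])
    fix \<sigma> assume "\<sigma> \<in> {\<sigma>. \<sigma> permutes {1..n}}"
    then have "sign (\<sigma> \<circ> \<tau>) = sign \<sigma> * sign \<tau>"
      using \<tau> by (intro sign_compose perm) auto
    moreover have "(\<Prod>i\<in>{1..n}. poly (?q ((\<sigma> \<circ> \<tau>) i)) (x (\<tau> i))) = (\<Prod>i\<in>{1..n}. poly (?q (\<sigma> i)) (x i))"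
      using prod.reindex_bij_betw[OF permutes_imp_bij[OF \<tau>], of "\<lambda>i. poly (?q (\<sigma> i)) (x i)"]
      by simp
    ultimately show "of_int (sign (\<sigma> \<circ> \<tau>)) * (\<Prod>i\<in>{1..n}. poly (?q ((\<sigma> \<circ> \<tau>) i)) (x (\<tau> i))) =
        of_int (sign \<tau>) * (of_int (sign \<sigma>) * (\<Prod>i\<in>{1..n}. poly (?q (\<sigma> i)) (x i)))"
      by (simp only: of_int_mult mult_ac)
  qed
  finally have "alternant ?q n (\<lambda>i. x (\<tau> i)) = of_int (sign \<tau>) * alternant ?q n x"
    by (simp only: alternant_def sum_distrib_left)
  then show ?thesis
    unfolding vdm_sgn_eq_sgn_alternant by (simp add: sgn_mult sign_def)
qed

lemma sgn_form_permute:
  assumes "\<tau> permutes {1..n}"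
  shows "sgn_form {1..n} (\<lambda>i. p (\<tau> i)) = of_int (sign \<tau>) * sgn_form {1..n} p"
  using permutes_imp_bij[OF assms] by (rule sgn_form_reindex) (simp, rule vdm_sgn_permute[OF assms])

lemma sgn_form_interval_eq_0:
  assumes "a \<in> {1..n}" "b \<in> {1..n}" "a \<noteq> b" "p a = p b"
  shows "sgn_form {1..n} p = 0"
proof -
  have "(\<lambda>i. p (Transposition.transpose a b i)) = p"
    using assms by (auto simp: Transposition.transpose_def)
  then show ?thesis
    using sgn_form_permute[of "Transposition.transpose a b" n p] assms
    by (simp add: permutes_swap_id sign_swap_id)
qed

text \<open>
  Two equal entries: the increasing enumeration of \<open>I\<close> reduces this to the case of an initial interval.
\<close>

lemma sgn_form_eq_0:
  assumes fin: "finite I" and ab: "a \<in> I" "b \<in> I" "a \<noteq> b" "p a = p b"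
  shows "sgn_form I p = 0"
proof -
  obtain h where h: "bij_betw h {..<card I} I" "strict_mono_on {..<card I} h"
    using ex_bij_betw_strict_mono_card[OF fin] by blast
  define \<pi> where "\<pi> i = h (i - 1)" for i
  have mono: "strict_mono_on {1..card I} \<pi>"
  proof (rule strict_mono_onI)
    fix r s assume "r \<in> {1..card I}" "s \<in> {1..card I}" "r < s"
    then show "\<pi> r < \<pi> s"
      unfolding \<pi>_def by (intro strict_mono_onD[OF h(2)]) auto
  qed
  have img: "\<pi> ` {1..card I} = I"
  proof -
    have "(\<lambda>i. i - 1) ` {1..card I} = {..<card I}"
      by (auto simp: image_iff intro!: bexI[of _ "Suc _"])
    then have "h ` (\<lambda>i. i - 1) ` {1..card I} = I" using h(1) by (simp add: bij_betw_def)
    then show ?thesis by (simp add: \<pi>_def image_image)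
  qed
  obtain i j where "i \<in> {1..card I}" "\<pi> i = a" "j \<in> {1..card I}" "\<pi> j = b"
    using ab img by (metis imageE)
  then have "sgn_form {1..card I} (\<lambda>i. p (\<pi> i)) = 0"
    using ab by (intro sgn_form_interval_eq_0[of i _ j]) auto
  then show ?thesis using sgn_form_reindex_mono[OF mono, of p] img by simp
qed

text \<open>
  The sign counts inversions: permute the increasing configuration \<open>x i = i\<close>, for which all factors
  of \<open>vdm_sgn\<close> are 1.
\<close>

lemma sign_eq_prod_sgn:
  assumes \<tau>: "\<tau> permutes {1..n}"
  shows "of_int (sign \<tau>) = (\<Prod>j\<in>{1..n}. \<Prod>i\<in>{1..<j}. sgn (real (\<tau> j) - real (\<tau> i)))"
proof -
  have eq: "vdm_sgn {1..n} x = (\<Prod>j\<in>{1..n}. \<Prod>i\<in>{1..<j}. sgn (x j - x i))" for x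
    unfolding vdm_sgn_def by (intro prod.cong) auto
  have "vdm_sgn {1..n} real = 1"
    unfolding eq by (intro prod.neutral ballI) auto
  with vdm_sgn_permute[OF \<tau>, of real]
  have "of_int (sign \<tau>) = vdm_sgn {1..n} (\<lambda>i. real (\<tau> i))" by simp
  then show ?thesis unfolding eq .
qed

section \<open>The partition function as an antisymmetrised sign form\<close>

lemma prod_atLeast1_Suc: "prod f {1..Suc k} = f 1 * (\<Prod>i\<in>{1..k}. f (Suc i))"
  for f :: "nat \<Rightarrow> 'a::comm_monoid_mult"
  by (simp add: prod.atLeast_Suc_atMost prod.shift_bounds_cl_Suc_ivl del: prod.cl_ivl_Suc)

lemma prod_atLeast1_less_Suc:
  "j \<ge> 1 \<Longrightarrow> prod f {1..<Suc j} = f 1 * (\<Prod>i\<in>{1..<j}. f (Suc i))"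
  for f :: "nat \<Rightarrow> 'a::comm_monoid_mult"
  by (simp add: prod.atLeast_Suc_lessThan prod.shift_bounds_Suc_ivl del: prod.op_ivl_Suc)

lemma prod_atLeast1_add:
  "prod f {1..N + k} = prod f {1..N} * (\<Prod>i\<in>{1..k}. f (N + i))"
  for f :: "nat \<Rightarrow> 'a::comm_monoid_mult"
  by (induction k) (simp_all add: mult.assoc)

lemma prod_atLeast1_less_add:
  "j \<ge> 1 \<Longrightarrow> prod f {1..<N + j} = prod f {1..N} * (\<Prod>i\<in>{1..<j}. f (N + i))"
  for f :: "nat \<Rightarrow> 'a::comm_monoid_mult"
  using prod_atLeast1_add[of f N "j - 1"]
  by (cases j) (simp_all add: atLeastLessThanSuc_atLeastAtMost)

lemma DERIV_at_zero_factor: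
  fixes R :: "real \<Rightarrow> real"
  assumes "isCont R y"
  shows "((\<lambda>z. (z - y) * R z) has_field_derivative R y) (at y)"
  unfolding CARAT_DERIV using assms by (intro exI[of _ R]) (auto simp: mult.commute)

text \<open>
  A particle of charge 2 at \<open>m\<close> is the collision of two unit charges at \<open>y\<close> and \<open>z\<close>: both the determinant
  and the Vandermonde product vanish at \<open>z = y\<close>, and comparing their derivatives in \<open>z\<close> there turns the
  column of \<open>z\<close> into a derivative and squares the interaction with every other particle. The Gaussian
  factors merge to \<open>exp (- m\<^sup>2)\<close>, the weight of a particle of charge 2.
\<close>

lemma confluent_vandermonde:
  assumes monic: "\<And>i. i \<ge> 1 \<Longrightarrow> degree (q i) = i - 1 \<and> lead_coeff (q i) = 1"
  shows "(\<Sum>\<sigma> | \<sigma> permutes {1..N + 2 * k}. of_int (sign \<sigma>) *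
      ((\<Prod>i\<in>{1..N}. gauss_poly (q (\<sigma> i)) (x i)) *
       (\<Prod>i\<in>{1..k}. gauss_poly (q (\<sigma> (N + 2 * i - 1))) (m i) *
          gauss_poly (gauss_deriv (q (\<sigma> (N + 2 * i)))) (m i)))) =
    ((\<Prod>i\<in>{1..N}. exp (- (x i)\<^sup>2 / 2)) * (\<Prod>i\<in>{1..k}. exp (- (m i)\<^sup>2))) *
    (\<Prod>j\<in>{1..N}. \<Prod>i\<in>{1..<j}. x j - x i) *
    (\<Prod>j\<in>{1..k}. \<Prod>i\<in>{1..N}. (m j - x i)\<^sup>2) *
    (\<Prod>j\<in>{1..k}. \<Prod>i\<in>{1..<j}. (m j - m i) ^ 4)"
proof (induction k arbitrary: N x m)
  case 0
  have "(\<Prod>i\<in>{1..N}. gauss_poly (q (\<sigma> i)) (x i)) =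
      (\<Prod>i\<in>{1..N}. exp (- (x i)\<^sup>2 / 2)) * (\<Prod>i\<in>{1..N}. poly (q (\<sigma> i)) (x i))" for \<sigma>
    unfolding gauss_poly_def prod.distrib by (rule mult.commute)
  then have "(\<Sum>\<sigma> | \<sigma> permutes {1..N}. of_int (sign \<sigma>) * (\<Prod>i\<in>{1..N}. gauss_poly (q (\<sigma> i)) (x i))) =
      (\<Prod>i\<in>{1..N}. exp (- (x i)\<^sup>2 / 2)) * alternant q N x"
    unfolding alternant_def sum_distrib_left by (simp only: mult_ac)
  then show ?case using alternant_vandermonde[OF monic, of N x] by simp
next
  case (Suc k)
  define y where "y = m 1"
  define A where "A \<sigma> = (\<Prod>i\<in>{1..N}. gauss_poly (q (\<sigma> i)) (x i)) *
    gauss_poly (q (\<sigma> (N + 1))) y" for \<sigma>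
  define C where "C \<sigma> = (\<Prod>i\<in>{1..k}. gauss_poly (q (\<sigma> (N + 2 + 2 * i - 1))) (m (Suc i)) *
    gauss_poly (gauss_deriv (q (\<sigma> (N + 2 + 2 * i)))) (m (Suc i)))" for \<sigma>
  define x' where "x' z = x(N + 1 := y, N + 2 := z)" for z
  define L where "L z = (\<Sum>\<sigma> | \<sigma> permutes {1..N + 2 * Suc k}. of_int (sign \<sigma>) *
    (A \<sigma> * gauss_poly (q (\<sigma> (N + 2))) z * C \<sigma>))" for z
  define R where "R z =
    ((\<Prod>i\<in>{1..N}. exp (- (x i)\<^sup>2 / 2)) * exp (- y\<^sup>2 / 2) * exp (- z\<^sup>2 / 2) *
      (\<Prod>i\<in>{1..k}. exp (- (m (Suc i))\<^sup>2))) *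
    ((\<Prod>j\<in>{1..N}. \<Prod>i\<in>{1..<j}. x j - x i) * (\<Prod>i\<in>{1..N}. y - x i) * (\<Prod>i\<in>{1..N}. z - x i)) *
    ((\<Prod>j\<in>{1..k}. \<Prod>i\<in>{1..N}. (m (Suc j) - x i)\<^sup>2) * (\<Prod>j\<in>{1..k}. (m (Suc j) - y)\<^sup>2) *
      (\<Prod>j\<in>{1..k}. (m (Suc j) - z)\<^sup>2)) *
    (\<Prod>j\<in>{1..k}. \<Prod>i\<in>{1..<j}. (m (Suc j) - m (Suc i)) ^ 4)" for z
  have x'_old: "x' z i = x i" if "i \<le> N" for z i using that by (auto simp: x'_def)
  have x'_new: "x' z (Suc N) = y" "x' z (Suc (Suc N)) = z" for z by (auto simp: x'_def)
  have split2: "prod f {1..N + 2} = prod f {1..N} * f (Suc N) * f (Suc (Suc N))" for f :: "nat \<Rightarrow> real"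
    by (simp add: mult.assoc)
  have prod_old: "(\<Prod>i\<in>{1..N}. g i (x' z i)) = (\<Prod>i\<in>{1..N}. g i (x i))" for g :: "nat \<Rightarrow> real \<Rightarrow> real" and z
    by (intro prod.cong) (auto simp: x'_old)
  have L_eq: "L z = (z - y) * R z" for z
  proof -
    have idx: "N + 2 + 2 * k = N + 2 * Suc k" by simp
    have vdm: "(\<Prod>j\<in>{1..N + 2}. \<Prod>i\<in>{1..<j}. x' z j - x' z i) =
        (\<Prod>j\<in>{1..N}. \<Prod>i\<in>{1..<j}. x j - x i) * (\<Prod>i\<in>{1..N}. y - x i) *
        ((\<Prod>i\<in>{1..N}. z - x i) * (z - y))"
    proof -
      have "(\<Prod>j\<in>{1..N}. \<Prod>i\<in>{1..<j}. x' z j - x' z i) = (\<Prod>j\<in>{1..N}. \<Prod>i\<in>{1..<j}. x j - x i)"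
        by (intro prod.cong) (auto simp: x'_old)
      moreover have "(\<Prod>i\<in>{1..<Suc N}. x' z (Suc N) - x' z i) = (\<Prod>i\<in>{1..N}. y - x i)"
        unfolding x'_new by (intro prod.cong) (auto simp: x'_old)
      moreover have "(\<Prod>i\<in>{1..<Suc (Suc N)}. x' z (Suc (Suc N)) - x' z i) =
          (\<Prod>i\<in>{1..N}. z - x i) * (z - y)"
        unfolding x'_new atLeastLessThanSuc_atLeastAtMost
        using prod_old[of "\<lambda>_ t. z - t"] by (simp add: x'_new)
      ultimately show ?thesis unfolding split2 by simp
    qed
    have cross: "(\<Prod>j\<in>{1..k}. \<Prod>i\<in>{1..N + 2}. (m (Suc j) - x' z i)\<^sup>2) =
        (\<Prod>j\<in>{1..k}. \<Prod>i\<in>{1..N}. (m (Suc j) - x i)\<^sup>2) * (\<Prod>j\<in>{1..k}. (m (Suc j) - y)\<^sup>2) *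
        (\<Prod>j\<in>{1..k}. (m (Suc j) - z)\<^sup>2)"
      unfolding split2 x'_new prod_old[of "\<lambda>_ t. (m (Suc _) - t)\<^sup>2"] prod.distrib
      by (simp add: prod_old)
    have "L z = (\<Sum>\<sigma> | \<sigma> permutes {1..N + 2 + 2 * k}. of_int (sign \<sigma>) *
      ((\<Prod>i\<in>{1..N + 2}. gauss_poly (q (\<sigma> i)) (x' z i)) *
       (\<Prod>i\<in>{1..k}. gauss_poly (q (\<sigma> (N + 2 + 2 * i - 1))) (m (Suc i)) *
          gauss_poly (gauss_deriv (q (\<sigma> (N + 2 + 2 * i)))) (m (Suc i)))))"
      unfolding L_def A_def C_def split2 x'_new idx
        prod_old[of "\<lambda>i. gauss_poly (q (_ i))"] by simp
    also have "\<dots> = (z - y) * R z"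
      unfolding Suc.IH[where N = "N + 2" and x = "x' z" and m = "\<lambda>i. m (Suc i)"] vdm cross R_def
      unfolding split2 x'_new prod_old[of "\<lambda>_ t. exp (- t\<^sup>2 / 2)"] by (simp only: mult_ac)
    finally show ?thesis .
  qed
  have "(L has_field_derivative (\<Sum>\<sigma> | \<sigma> permutes {1..N + 2 * Suc k}. of_int (sign \<sigma>) *
    (A \<sigma> * gauss_poly (gauss_deriv (q (\<sigma> (N + 2)))) y * C \<sigma>))) (at y)"
    unfolding L_def [abs_def]
    by (intro DERIV_sum DERIV_cmult DERIV_cmult_right DERIV_gauss_poly)
  moreover have "isCont R y"
    unfolding R_def [abs_def] by (intro continuous_intros) auto
  then have "(L has_field_derivative R y) (at y)"
    unfolding L_eq [abs_def] by (rule DERIV_at_zero_factor)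
  ultimately have eq: "(\<Sum>\<sigma> | \<sigma> permutes {1..N + 2 * Suc k}. of_int (sign \<sigma>) *
    (A \<sigma> * gauss_poly (gauss_deriv (q (\<sigma> (N + 2)))) y * C \<sigma>)) = R y"
    by (rule DERIV_unique)
  have lhs: "A \<sigma> * gauss_poly (gauss_deriv (q (\<sigma> (N + 2)))) y * C \<sigma> =
      (\<Prod>i\<in>{1..N}. gauss_poly (q (\<sigma> i)) (x i)) *
      (\<Prod>i\<in>{1..Suc k}. gauss_poly (q (\<sigma> (N + 2 * i - 1))) (m i) *
          gauss_poly (gauss_deriv (q (\<sigma> (N + 2 * i)))) (m i))" for \<sigma>
    unfolding prod_atLeast1_Suc A_def C_def y_def by (simp add: mult_ac)
  have "R y = ((\<Prod>i\<in>{1..N}. exp (- (x i)\<^sup>2 / 2)) * (\<Prod>i\<in>{1..Suc k}. exp (- (m i)\<^sup>2))) *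
    (\<Prod>j\<in>{1..N}. \<Prod>i\<in>{1..<j}. x j - x i) *
    (\<Prod>j\<in>{1..Suc k}. \<Prod>i\<in>{1..N}. (m j - x i)\<^sup>2) *
    (\<Prod>j\<in>{1..Suc k}. \<Prod>i\<in>{1..<j}. (m j - m i) ^ 4)"
  proof -
    have "exp (- y\<^sup>2 / 2) * exp (- y\<^sup>2 / 2) = exp (- y\<^sup>2)"
      by (simp add: exp_add[symmetric])
    then have 1: "(\<Prod>i\<in>{1..Suc k}. exp (- (m i)\<^sup>2)) =
        exp (- y\<^sup>2 / 2) * exp (- y\<^sup>2 / 2) * (\<Prod>i\<in>{1..k}. exp (- (m (Suc i))\<^sup>2))"
      unfolding prod_atLeast1_Suc y_def by simp
    have 2: "(\<Prod>j\<in>{1..Suc k}. \<Prod>i\<in>{1..N}. (m j - x i)\<^sup>2) =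
        (\<Prod>i\<in>{1..N}. y - x i) * (\<Prod>i\<in>{1..N}. y - x i) *
        (\<Prod>j\<in>{1..k}. \<Prod>i\<in>{1..N}. (m (Suc j) - x i)\<^sup>2)"
      unfolding prod_atLeast1_Suc y_def by (simp add: power2_eq_square prod.distrib)
    have "(\<Prod>j\<in>{1..k}. \<Prod>i\<in>{1..<Suc j}. (m (Suc j) - m i) ^ 4) =
        (\<Prod>j\<in>{1..k}. (m (Suc j) - y) ^ 4 * (\<Prod>i\<in>{1..<j}. (m (Suc j) - m (Suc i)) ^ 4))"
      unfolding y_def by (intro prod.cong refl prod_atLeast1_less_Suc) auto
    also have "\<dots> = (\<Prod>j\<in>{1..k}. (m (Suc j) - y)\<^sup>2) * (\<Prod>j\<in>{1..k}. (m (Suc j) - y)\<^sup>2) *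
        (\<Prod>j\<in>{1..k}. \<Prod>i\<in>{1..<j}. (m (Suc j) - m (Suc i)) ^ 4)"
      unfolding prod.distrib[symmetric] by (intro prod.cong refl) (simp add: power4_eq_xxxx power2_eq_square)
    finally have 3: "(\<Prod>j\<in>{1..Suc k}. \<Prod>i\<in>{1..<j}. (m j - m i) ^ 4) =
        (\<Prod>j\<in>{1..k}. (m (Suc j) - y)\<^sup>2) * (\<Prod>j\<in>{1..k}. (m (Suc j) - y)\<^sup>2) *
        (\<Prod>j\<in>{1..k}. \<Prod>i\<in>{1..<j}. (m (Suc j) - m (Suc i)) ^ 4)"
      unfolding prod_atLeast1_Suc[of "\<lambda>j. \<Prod>i\<in>{1..<j}. (m j - m i) ^ 4"] by simp
    show ?thesis unfolding R_def 1 2 3 by (simp only: mult_ac)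
  qed
  with eq show ?case unfolding lhs by simp
qed

lemma integral_vdm_sgn_split:
  fixes f :: "nat \<Rightarrow> real \<Rightarrow> real"
  assumes fin: "finite I" "finite J" and disj: "I \<inter> J = {}"
    and int: "\<And>i. i \<in> I \<union> J \<Longrightarrow> integrable lborel (f i)"
  shows "(\<integral>x. vdm_sgn I x * (\<Prod>i\<in>I \<union> J. f i (x i)) \<partial>(\<Pi>\<^sub>M i\<in>I \<union> J. lborel)) =
    (\<integral>x. vdm_sgn I x * (\<Prod>i\<in>I. f i (x i)) \<partial>(\<Pi>\<^sub>M i\<in>I. lborel)) * (\<Prod>j\<in>J. \<integral>t. f j t \<partial>lborel)"
proof -
  interpret product_sigma_finite "\<lambda>_. lborel :: real measure"
    by (rule product_sigma_finite_lborel)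
  have "(\<integral>x. vdm_sgn I x * (\<Prod>i\<in>I \<union> J. f i (x i)) \<partial>(\<Pi>\<^sub>M i\<in>I \<union> J. lborel)) =
      (\<integral>x. (\<integral>y. vdm_sgn I (merge I J (x, y)) * (\<Prod>i\<in>I \<union> J. f i (merge I J (x, y) i))
        \<partial>(\<Pi>\<^sub>M i\<in>J. lborel)) \<partial>(\<Pi>\<^sub>M i\<in>I. lborel))"
    using fin int by (intro product_integral_fold disj integrable_bounded_mult_prod abs_vdm_sgn_le_1
        vdm_sgn_measurable) auto
  also have "\<dots> = (\<integral>x. (\<integral>y. vdm_sgn I x * (\<Prod>i\<in>I. f i (x i)) * (\<Prod>j\<in>J. f j (y j))
        \<partial>(\<Pi>\<^sub>M i\<in>J. lborel)) \<partial>(\<Pi>\<^sub>M i\<in>I. lborel))"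
  proof (intro Bochner_Integration.integral_cong refl)
    fix x y :: "nat \<Rightarrow> real"
    have "vdm_sgn I (merge I J (x, y)) = vdm_sgn I x"
      by (rule vdm_sgn_cong) (auto simp: merge_def)
    moreover have "(\<Prod>i\<in>I \<union> J. f i (merge I J (x, y) i)) =
        (\<Prod>i\<in>I. f i (merge I J (x, y) i)) * (\<Prod>j\<in>J. f j (merge I J (x, y) j))"
      using fin disj by (intro prod.union_disjoint)
    moreover have "(\<Prod>i\<in>I. f i (merge I J (x, y) i)) = (\<Prod>i\<in>I. f i (x i))"
      by (intro prod.cong) (auto simp: merge_def)
    moreover have "(\<Prod>j\<in>J. f j (merge I J (x, y) j)) = (\<Prod>j\<in>J. f j (y j))"
      using disj by (intro prod.cong) (auto simp: merge_def)
    ultimately show "vdm_sgn I (merge I J (x, y)) * (\<Prod>i\<in>I \<union> J. f i (merge I J (x, y) i)) =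
        vdm_sgn I x * (\<Prod>i\<in>I. f i (x i)) * (\<Prod>j\<in>J. f j (y j))"
      by simp
  qed
  also have "\<dots> = (\<integral>x. vdm_sgn I x * (\<Prod>i\<in>I. f i (x i)) * (\<Prod>j\<in>J. \<integral>t. f j t \<partial>lborel)
        \<partial>(\<Pi>\<^sub>M i\<in>I. lborel))"
    using fin int by (simp add: product_integral_prod)
  finally show ?thesis by simp
qed

text \<open>
  Only the interactions between two unit charges have odd exponent, so their signs alone separate the
  weight from the confluent Vandermonde product.
\<close>

lemma log_gas_weight_eq:
  "log_gas_weight N k x = vdm_sgn {1..N} x *
    (((\<Prod>i\<in>{1..N}. exp (- (x i)\<^sup>2 / 2)) * (\<Prod>i\<in>{1..k}. exp (- (x (N + i))\<^sup>2))) *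
    (\<Prod>j\<in>{1..N}. \<Prod>i\<in>{1..<j}. x j - x i) *
    (\<Prod>j\<in>{1..k}. \<Prod>i\<in>{1..N}. (x (N + j) - x i)\<^sup>2) *
    (\<Prod>j\<in>{1..k}. \<Prod>i\<in>{1..<j}. (x (N + j) - x (N + i)) ^ 4))"
proof -
  have expo: "exp (- (\<Sum>i\<in>{1..N + k}. real (charge N i) * (x i)\<^sup>2 / 2)) =
      (\<Prod>i\<in>{1..N}. exp (- (x i)\<^sup>2 / 2)) * (\<Prod>i\<in>{1..k}. exp (- (x (N + i))\<^sup>2))"
  proof -
    have "exp (- (\<Sum>i\<in>{1..N + k}. real (charge N i) * (x i)\<^sup>2 / 2)) =
        (\<Prod>i\<in>{1..N + k}. exp (- (real (charge N i) * (x i)\<^sup>2 / 2)))"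
      by (simp add: exp_sum sum_negf[symmetric] del: sum_negf)
    also have "\<dots> = (\<Prod>i\<in>{1..N}. exp (- (real (charge N i) * (x i)\<^sup>2 / 2))) *
        (\<Prod>i\<in>{1..k}. exp (- (real (charge N (N + i)) * (x (N + i))\<^sup>2 / 2)))"
      by (rule prod_atLeast1_add)
    also have "\<dots> = (\<Prod>i\<in>{1..N}. exp (- (x i)\<^sup>2 / 2)) * (\<Prod>i\<in>{1..k}. exp (- (x (N + i))\<^sup>2))"
      by (intro arg_cong2[where f = "(*)"] prod.cong refl) (auto simp: charge_def)
    finally show ?thesis .
  qed
  let ?F = "\<lambda>j l. \<bar>x j - x l\<bar> ^ (charge N j * charge N l)"
  have "(\<Prod>(j, l)\<in>{(j, l). 1 \<le> j \<and> j < l \<and> l \<le> N + k}. ?F j l) =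
      (\<Prod>l\<in>{1..N + k}. \<Prod>j\<in>{1..<l}. ?F j l)"
    unfolding prod.Sigma[OF finite_atLeastAtMost ballI[OF finite_atLeastLessThan]]
    by (rule prod.reindex_bij_witness[where i = "\<lambda>(l, j). (j, l)" and j = "\<lambda>(j, l). (l, j)"]) auto
  also have "\<dots> = (\<Prod>l\<in>{1..N}. \<Prod>j\<in>{1..<l}. ?F j l) *
      (\<Prod>l\<in>{1..k}. \<Prod>j\<in>{1..<N + l}. ?F j (N + l))"
    by (rule prod_atLeast1_add)
  also have "(\<Prod>l\<in>{1..N}. \<Prod>j\<in>{1..<l}. ?F j l) =
      (\<Prod>l\<in>{1..N}. \<Prod>j\<in>{1..<l}. sgn (x l - x j) * (x l - x j))"
    by (intro prod.cong refl) (auto simp: charge_def abs_if sgn_if)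
  also have "\<dots> = vdm_sgn {1..N} x * (\<Prod>l\<in>{1..N}. \<Prod>j\<in>{1..<l}. x l - x j)"
  proof -
    have "vdm_sgn {1..N} x = (\<Prod>j\<in>{1..N}. \<Prod>i\<in>{1..<j}. sgn (x j - x i))"
      unfolding vdm_sgn_def by (intro prod.cong) auto
    then show ?thesis by (simp only: prod.distrib)
  qed
  also have "(\<Prod>l\<in>{1..k}. \<Prod>j\<in>{1..<N + l}. ?F j (N + l)) =
      (\<Prod>l\<in>{1..k}. (\<Prod>i\<in>{1..N}. (x (N + l) - x i)\<^sup>2) *
        (\<Prod>i\<in>{1..<l}. (x (N + l) - x (N + i)) ^ 4))"
  proof (rule prod.cong[OF refl])
    fix l assume l: "l \<in> {1..k}"
    then have "(\<Prod>j\<in>{1..<N + l}. ?F j (N + l)) =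
        (\<Prod>i\<in>{1..N}. ?F i (N + l)) * (\<Prod>i\<in>{1..<l}. ?F (N + i) (N + l))"
      by (intro prod_atLeast1_less_add) auto
    also have "(\<Prod>i\<in>{1..N}. ?F i (N + l)) = (\<Prod>i\<in>{1..N}. (x (N + l) - x i)\<^sup>2)"
      using l by (intro prod.cong refl) (auto simp: charge_def power2_commute)
    also have "(\<Prod>i\<in>{1..<l}. ?F (N + i) (N + l)) = (\<Prod>i\<in>{1..<l}. (x (N + l) - x (N + i)) ^ 4)"
    proof (rule prod.cong[OF refl])
      fix i assume "i \<in> {1..<l}"
      then have "?F (N + i) (N + l) = \<bar>x (N + l) - x (N + i)\<bar> ^ 4"
        by (simp add: charge_def abs_minus_commute)
      then show "?F (N + i) (N + l) = (x (N + l) - x (N + i)) ^ 4"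
        by (simp add: power_even_abs)
    qed
    finally show "(\<Prod>j\<in>{1..<N + l}. ?F j (N + l)) = (\<Prod>i\<in>{1..N}. (x (N + l) - x i)\<^sup>2) *
        (\<Prod>i\<in>{1..<l}. (x (N + l) - x (N + i)) ^ 4)" .
  qed
  finally show ?thesis
    unfolding log_gas_weight_def expo by (simp only: prod.distrib mult_ac)
qed

lemma gen_partition_fun_eq_sum:
  assumes monic: "\<And>i. i \<ge> 1 \<Longrightarrow> degree (q i) = i - 1 \<and> lead_coeff (q i) = 1"
  shows "gen_partition_fun N k = (\<Sum>\<sigma> | \<sigma> permutes {1..N + 2 * k}. of_int (sign \<sigma>) *
    (sgn_form {1..N} (\<lambda>i. q (\<sigma> i)) *
      (\<Prod>i\<in>{1..k}. gauss_inner (q (\<sigma> (N + 2 * i - 1))) (gauss_deriv (q (\<sigma> (N + 2 * i)))))))"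
proof -
  let ?J = "{N + 1..N + k}"
  have IJ: "{1..N + k} = {1..N} \<union> ?J" by auto
  define f where "f \<sigma> i t = (if i \<le> N then gauss_poly (q (\<sigma> i)) t else
    gauss_poly (q (\<sigma> (N + 2 * (i - N) - 1))) t * gauss_poly (gauss_deriv (q (\<sigma> (N + 2 * (i - N))))) t)"
    for \<sigma> i t
  have int_f: "integrable lborel (f \<sigma> i)" for \<sigma> i
    unfolding f_def [abs_def] by (cases "i \<le> N") (auto intro: integrable_gauss_poly integrable_gauss_poly_mult)
  have low: "(\<Prod>i\<in>{1..N}. f \<sigma> i (x i)) = (\<Prod>i\<in>{1..N}. gauss_poly (q (\<sigma> i)) (x i))" for \<sigma> x
    by (intro prod.cong) (auto simp: f_def)
  have prod_f: "(\<Prod>i\<in>{1..N + k}. f \<sigma> i (x i)) = (\<Prod>i\<in>{1..N}. gauss_poly (q (\<sigma> i)) (x i)) *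
      (\<Prod>i\<in>{1..k}. gauss_poly (q (\<sigma> (N + 2 * i - 1))) (x (N + i)) *
        gauss_poly (gauss_deriv (q (\<sigma> (N + 2 * i)))) (x (N + i)))" for \<sigma> x
    unfolding prod_atLeast1_add low
    by (intro arg_cong2[where f = "(*)"] prod.cong refl) (auto simp: f_def)
  have weight: "log_gas_weight N k x = (\<Sum>\<sigma> | \<sigma> permutes {1..N + 2 * k}. of_int (sign \<sigma>) *
      (vdm_sgn {1..N} x * (\<Prod>i\<in>{1..N + k}. f \<sigma> i (x i))))" for x
  proof -
    have "(\<Sum>\<sigma> | \<sigma> permutes {1..N + 2 * k}. of_int (sign \<sigma>) *
        (vdm_sgn {1..N} x * (\<Prod>i\<in>{1..N + k}. f \<sigma> i (x i)))) =
      vdm_sgn {1..N} x * (\<Sum>\<sigma> | \<sigma> permutes {1..N + 2 * k}. of_int (sign \<sigma>) *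
        ((\<Prod>i\<in>{1..N}. gauss_poly (q (\<sigma> i)) (x i)) *
         (\<Prod>i\<in>{1..k}. gauss_poly (q (\<sigma> (N + 2 * i - 1))) (x (N + i)) *
            gauss_poly (gauss_deriv (q (\<sigma> (N + 2 * i)))) (x (N + i)))))"
      unfolding sum_distrib_left prod_f by (simp only: mult.left_commute)
    also have "\<dots> = log_gas_weight N k x"
      unfolding log_gas_weight_eq
      by (rule arg_cong[where f = "(*) (vdm_sgn {1..N} x)"], rule confluent_vandermonde, rule monic)
    finally show ?thesis ..
  qed
  have "gen_partition_fun N k = (\<integral>x. (\<Sum>\<sigma> | \<sigma> permutes {1..N + 2 * k}. of_int (sign \<sigma>) *
      (vdm_sgn {1..N} x * (\<Prod>i\<in>{1..N + k}. f \<sigma> i (x i)))) \<partial>(\<Pi>\<^sub>M i\<in>{1..N + k}. lborel))"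
    unfolding gen_partition_fun_def weight ..
  also have "\<dots> = (\<Sum>\<sigma> | \<sigma> permutes {1..N + 2 * k}. \<integral>x. of_int (sign \<sigma>) *
      (vdm_sgn {1..N} x * (\<Prod>i\<in>{1..N + k}. f \<sigma> i (x i))) \<partial>(\<Pi>\<^sub>M i\<in>{1..N + k}. lborel))"
    by (intro Bochner_Integration.integral_sum integrable_mult_right integrable_bounded_mult_prod
        int_f abs_vdm_sgn_le_1 vdm_sgn_measurable) auto
  also have "\<dots> = (\<Sum>\<sigma> | \<sigma> permutes {1..N + 2 * k}. of_int (sign \<sigma>) *
    (sgn_form {1..N} (\<lambda>i. q (\<sigma> i)) *
      (\<Prod>i\<in>{1..k}. gauss_inner (q (\<sigma> (N + 2 * i - 1))) (gauss_deriv (q (\<sigma> (N + 2 * i)))))))"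
  proof (rule sum.cong[OF refl])
    fix \<sigma>
    have "(\<integral>x. vdm_sgn {1..N} x * (\<Prod>i\<in>{1..N + k}. f \<sigma> i (x i)) \<partial>(\<Pi>\<^sub>M i\<in>{1..N + k}. lborel)) =
        (\<integral>x. vdm_sgn {1..N} x * (\<Prod>i\<in>{1..N}. f \<sigma> i (x i)) \<partial>(\<Pi>\<^sub>M i\<in>{1..N}. lborel)) *
        (\<Prod>j\<in>?J. \<integral>t. f \<sigma> j t \<partial>lborel)"
      unfolding IJ by (rule integral_vdm_sgn_split) (auto intro: int_f)
    also have "(\<integral>x. vdm_sgn {1..N} x * (\<Prod>i\<in>{1..N}. f \<sigma> i (x i)) \<partial>(\<Pi>\<^sub>M i\<in>{1..N}. lborel)) =
        sgn_form {1..N} (\<lambda>i. q (\<sigma> i))"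
      unfolding sgn_form_def low ..
    also have "(\<Prod>j\<in>?J. \<integral>t. f \<sigma> j t \<partial>lborel) = (\<Prod>i\<in>{1..k}. \<integral>t. f \<sigma> (N + i) t \<partial>lborel)"
      by (rule prod.reindex_bij_witness[where i = "\<lambda>i. N + i" and j = "\<lambda>j. j - N"]) auto
    also have "\<dots> = (\<Prod>i\<in>{1..k}. gauss_inner (q (\<sigma> (N + 2 * i - 1))) (gauss_deriv (q (\<sigma> (N + 2 * i)))))"
      by (intro prod.cong) (auto simp: f_def gauss_inner_def)
    finally show "(\<integral>x. of_int (sign \<sigma>) * (vdm_sgn {1..N} x * (\<Prod>i\<in>{1..N + k}. f \<sigma> i (x i)))
        \<partial>(\<Pi>\<^sub>M i\<in>{1..N + k}. lborel)) = of_int (sign \<sigma>) * (sgn_form {1..N} (\<lambda>i. q (\<sigma> i)) *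
      (\<Prod>i\<in>{1..k}. gauss_inner (q (\<sigma> (N + 2 * i - 1))) (gauss_deriv (q (\<sigma> (N + 2 * i))))))"
      by (simp only: integral_mult_right_zero)
  qed
  finally show ?thesis .
qed

section \<open>From merged pairs to derivatives\<close>

text \<open>
  Antisymmetrisation over all ways of distributing the functions \<open>q\<close> over \<open>N\<close> plain entries of the sign
  form, \<open>r\<close> differentiated entries, and \<open>s\<close> pairs merged into a particle of charge 2. For \<open>r = 0\<close> and monic \<open>q\<close>
  of increasing degree it is a partition function; for \<open>s = 0\<close> it involves derivatives only.
\<close>

definition mixed_sum :: "(nat \<Rightarrow> real poly) \<Rightarrow> nat \<Rightarrow> nat \<Rightarrow> nat \<Rightarrow> real" where
  "mixed_sum q N r s = (\<Sum>\<sigma> | \<sigma> permutes {1..N + r + 2 * s}. of_int (sign \<sigma>) *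
    (sgn_form {1..N + r} (\<lambda>i. if i \<le> N then q (\<sigma> i) else gauss_deriv (q (\<sigma> i))) *
     (\<Prod>i\<in>{1..s}. gauss_inner (q (\<sigma> (N + r + 2 * i - 1))) (gauss_deriv (q (\<sigma> (N + r + 2 * i)))))))"

lemma gauss_inner_deriv_antisym:
  "gauss_inner p (gauss_deriv q) = - gauss_inner q (gauss_deriv p)"
  using gauss_inner_deriv[of q p] by (simp add: gauss_inner_commute)

text \<open>
  Contract one derivative. Gluing it to a plain entry contributes a symmetric overlap, which the
  antisymmetrisation kills; gluing it to one of the \<open>r + 1\<close> other derivatives creates a merged pair, and
  by antisymmetry all these choices contribute equally. The factor 2 is the jump of \<open>sgn\<close>.
\<close>

lemma mixed_sum_step:
  "mixed_sum q N (r + 2) s = 2 * real (r + 1) * mixed_sum q N r (s + 1)"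
proof -
  let ?M = "N + r + 2"
  let ?S = "{1..?M + 2 * s}"
  let ?P = "{\<sigma>. \<sigma> permutes ?S}"
  define g where "g \<sigma> i = (if i \<le> N then q (\<sigma> i) else gauss_deriv (q (\<sigma> i)))" for \<sigma> :: "nat \<Rightarrow> nat" and i
  define w where "w \<sigma> = (\<Prod>i\<in>{1..s}. gauss_inner (q (\<sigma> (?M + 2 * i - 1)))
    (gauss_deriv (q (\<sigma> (?M + 2 * i)))))" for \<sigma> :: "nat \<Rightarrow> nat"
  define T where "T j \<sigma> = gauss_inner (q (\<sigma> ?M)) (g \<sigma> j) * sgn_form ({1..N + r + 1} - {j}) (g \<sigma>) * w \<sigma>"
    for j :: nat and \<sigma> :: "nat \<Rightarrow> nat"
  define U where "U j = (\<Sum>\<sigma>\<in>?P. of_int (sign \<sigma>) * T j \<sigma>)" for j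
  have w_cong: "w \<sigma>' = w \<sigma>" if "\<And>i. i > ?M \<Longrightarrow> \<sigma>' i = \<sigma> i" for \<sigma>' \<sigma>
    unfolding w_def by (intro prod.cong refl) (auto simp: that)
  have peel: "sgn_form {1..?M} (g \<sigma>) * w \<sigma> =
      (\<Sum>j\<in>{1..N + r + 1}. 2 * (-1) ^ (N + r + j) * T j \<sigma>)" for \<sigma>
  proof -
    have "sgn_form {1..?M} (g \<sigma>) = 2 * (-1) ^ card {i\<in>{1..?M}. i < ?M} *
      (\<Sum>j\<in>{1..?M} - {?M}. (-1) ^ card {i\<in>{1..?M} - {?M}. i < j} *
        gauss_inner (q (\<sigma> ?M)) (g \<sigma> j) * sgn_form ({1..?M} - {?M, j}) (g \<sigma>))"
      by (rule sgn_form_deriv) (auto simp: g_def)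
    also have "{i\<in>{1..?M}. i < ?M} = {1..N + r + 1}" by auto
    also have "{1..?M} - {?M} = {1..N + r + 1}" by auto
    also have "(\<Sum>j\<in>{1..N + r + 1}. (-1) ^ card {i\<in>{1..N + r + 1}. i < j} *
        gauss_inner (q (\<sigma> ?M)) (g \<sigma> j) * sgn_form ({1..?M} - {?M, j}) (g \<sigma>)) =
      (\<Sum>j\<in>{1..N + r + 1}. (-1) ^ (j - 1) *
        gauss_inner (q (\<sigma> ?M)) (g \<sigma> j) * sgn_form ({1..N + r + 1} - {j}) (g \<sigma>))"
    proof (rule sum.cong[OF refl])
      fix j assume j: "j \<in> {1..N + r + 1}"
      then have "{i\<in>{1..N + r + 1}. i < j} = {1..<j}" "{1..?M} - {?M, j} = {1..N + r + 1} - {j}"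
        by auto
      then show "(-1) ^ card {i\<in>{1..N + r + 1}. i < j} *
        gauss_inner (q (\<sigma> ?M)) (g \<sigma> j) * sgn_form ({1..?M} - {?M, j}) (g \<sigma>) =
        (-1) ^ (j - 1) *
        gauss_inner (q (\<sigma> ?M)) (g \<sigma> j) * sgn_form ({1..N + r + 1} - {j}) (g \<sigma>)"
        by simp
    qed
    finally have "sgn_form {1..?M} (g \<sigma>) * w \<sigma> = (\<Sum>j\<in>{1..N + r + 1}.
        (2 * (-1) ^ (N + r + 1) * (-1) ^ (j - 1)) * T j \<sigma>)"
      by (simp only: T_def sum_distrib_left sum_distrib_right mult_ac card_atLeastAtMost diff_Suc_1)
    also have "\<dots> = (\<Sum>j\<in>{1..N + r + 1}. 2 * (-1) ^ (N + r + j) * T j \<sigma>)"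
    proof (rule sum.cong[OF refl])
      fix j assume "j \<in> {1..N + r + 1}"
      then have "N + r + 1 + (j - 1) = N + r + j" by auto
      then have "(-1::real) ^ (N + r + 1) * (-1) ^ (j - 1) = (-1) ^ (N + r + j)"
        by (metis power_add)
      then show "(2 * (-1) ^ (N + r + 1) * (-1) ^ (j - 1)) * T j \<sigma> = 2 * (-1) ^ (N + r + j) * T j \<sigma>"
        by (simp only: mult.assoc [of 2])
    qed
    finally show ?thesis .
  qed
  have "mixed_sum q N (r + 2) s = (\<Sum>\<sigma>\<in>?P. of_int (sign \<sigma>) * (sgn_form {1..?M} (g \<sigma>) * w \<sigma>))"
    unfolding mixed_sum_def g_def [abs_def] w_def by (simp only: add.assoc)
  also have "\<dots> = (\<Sum>j\<in>{1..N + r + 1}. 2 * (-1) ^ (N + r + j) * U j)"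
    unfolding peel U_def sum_distrib_left
    by (subst sum.swap) (simp only: mult_ac)
  \<comment> \<open>The overlap of two plain entries is symmetric under exchanging them.\<close>
  also have "\<dots> = (\<Sum>j\<in>{N + 1..N + r + 1}. 2 * (-1) ^ (N + r + j) * U j)"
  proof (rule sum.mono_neutral_right)
    show "\<forall>j\<in>{1..N + r + 1} - {N + 1..N + r + 1}. 2 * (-1) ^ (N + r + j) * U j = 0"
    proof
      fix j assume "j \<in> {1..N + r + 1} - {N + 1..N + r + 1}"
      then have j: "1 \<le> j" "j \<le> N" by auto
      have "U j = 0"
        unfolding U_def
      proof (rule sum_permutes_swap_eq_0[where a = j and b = ?M])
        fix \<sigma> :: "nat \<Rightarrow> nat"
        let ?\<sigma> = "\<sigma> \<circ> Transposition.transpose j ?M"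
        have "sgn_form ({1..N + r + 1} - {j}) (g ?\<sigma>) = sgn_form ({1..N + r + 1} - {j}) (g \<sigma>)"
          by (rule sgn_form_cong) (auto simp: g_def Transposition.transpose_def)
        moreover have "w ?\<sigma> = w \<sigma>"
          using j by (intro w_cong) (auto simp: Transposition.transpose_def)
        moreover have "gauss_inner (q (?\<sigma> ?M)) (g ?\<sigma> j) = gauss_inner (q (\<sigma> ?M)) (g \<sigma> j)"
          using j by (simp add: g_def gauss_inner_commute)
        ultimately show "T j ?\<sigma> = T j \<sigma>" by (simp add: T_def)
      qed (use j in auto)
      then show "2 * (-1) ^ (N + r + j) * U j = 0" by simp
    qed
  qed auto
  also have "\<dots> = (\<Sum>j\<in>{N + 1..N + r + 1}. - 2 * U (N + r + 1))"
  proof (rule sum.cong[OF refl])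
    fix j assume "j \<in> {N + 1..N + r + 1}"
    \<comment> \<open>Moving the glued position by one: the adjacent transposition changes the sign of the
        permutation, and increasing relabelling leaves the sign form unchanged.\<close>
    have step: "U j = - U (Suc j)" if j: "N + 1 \<le> j" "j \<le> N + r" for j
    proof -
      let ?\<tau> = "Transposition.transpose j (Suc j)"
      have \<tau>: "?\<tau> permutes ?S" using j by (intro permutes_swap_id) auto
      have "U j = (\<Sum>\<sigma>\<in>?P. of_int (sign (\<sigma> \<circ> ?\<tau>)) * T j (\<sigma> \<circ> ?\<tau>))"
        unfolding U_def by (rule sum_permutations_compose_right[OF \<tau>])
      also have "\<dots> = (\<Sum>\<sigma>\<in>?P. - (of_int (sign \<sigma>) * T (Suc j) \<sigma>))"
      proof (rule sum.cong[OF refl])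
        fix \<sigma> assume "\<sigma> \<in> ?P"
        then have \<sigma>: "permutation \<sigma>" by (auto intro: permutes_imp_permutation[rotated])
        have "permutation ?\<tau>" using \<tau> by (rule permutes_imp_permutation[rotated]) simp
        with \<sigma> have sgn: "sign (\<sigma> \<circ> ?\<tau>) = - sign \<sigma>"
          by (simp add: sign_compose sign_swap_id)
        let ?I = "{1..N + r + 1} - {Suc j}"
        have g_\<tau>: "g (\<sigma> \<circ> ?\<tau>) (?\<tau> i) = g \<sigma> i" for i
          using j by (auto simp: g_def Transposition.transpose_def)
        have img: "?\<tau> ` ?I = {1..N + r + 1} - {j}"
          using j by (auto simp: Transposition.transpose_def image_iff)
        have "strict_mono_on ?I ?\<tau>"
          by (rule strict_mono_onI) (auto simp: Transposition.transpose_def)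
        then have "sgn_form ?I (\<lambda>i. g (\<sigma> \<circ> ?\<tau>) (?\<tau> i)) = sgn_form (?\<tau> ` ?I) (g (\<sigma> \<circ> ?\<tau>))"
          by (rule sgn_form_reindex_mono) simp
        then have "sgn_form ({1..N + r + 1} - {j}) (g (\<sigma> \<circ> ?\<tau>)) = sgn_form ?I (g \<sigma>)"
          unfolding img g_\<tau> by simp
        moreover have "w (\<sigma> \<circ> ?\<tau>) = w \<sigma>"
          using j by (intro w_cong) (auto simp: Transposition.transpose_def)
        moreover have "g (\<sigma> \<circ> ?\<tau>) j = g \<sigma> (Suc j)" using g_\<tau>[of "Suc j"] by simp
        moreover have "(\<sigma> \<circ> ?\<tau>) ?M = \<sigma> ?M" using j by (auto simp: Transposition.transpose_def)
        ultimately have "T j (\<sigma> \<circ> ?\<tau>) = T (Suc j) \<sigma>" by (simp only: T_def)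
        then show "of_int (sign (\<sigma> \<circ> ?\<tau>)) * T j (\<sigma> \<circ> ?\<tau>) = - (of_int (sign \<sigma>) * T (Suc j) \<sigma>)"
          using sgn by simp
      qed
      also have "\<dots> = - U (Suc j)" by (simp add: U_def sum_negf)
      finally show ?thesis .
    qed
    have "j \<le> N + r + 1" "N + 1 \<le> j" using \<open>j \<in> {N + 1..N + r + 1}\<close> by auto
    then show "2 * (-1) ^ (N + r + j) * U j = - 2 * U (N + r + 1)"
    proof (induction j rule: inc_induct)
      case base
      have "(-1::real) ^ (N + r + (N + r + 1)) = - 1"
        by (simp add: mult_2[symmetric])
      then show ?case by simp
    next
      case (step j)
      then show ?case using \<open>\<And>j. N + 1 \<le> j \<Longrightarrow> j \<le> N + r \<Longrightarrow> U j = - U (Suc j)\<close>[of j] by simp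
    qed
  qed
  also have "\<dots> = 2 * real (r + 1) * (- U (N + r + 1))" by simp
  also have "- U (N + r + 1) = mixed_sum q N r (s + 1)"
  proof -
    have idx: "N + r + 2 * (s + 1) = ?M + 2 * s" by simp
    have "- U (N + r + 1) = (\<Sum>\<sigma>\<in>?P. of_int (sign \<sigma>) * (- T (N + r + 1) \<sigma>))"
      by (simp add: U_def sum_negf)
    also have "\<dots> = mixed_sum q N r (s + 1)"
      unfolding mixed_sum_def idx
    proof (intro sum.cong refl arg_cong[where f = "(*) (of_int _)"])
      fix \<sigma> :: "nat \<Rightarrow> nat"
      have "{1..N + r + 1} - {N + r + 1} = {1..N + r}" by auto
      moreover have "g \<sigma> (N + r + 1) = gauss_deriv (q (\<sigma> (N + r + 1)))" by (simp add: g_def)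
      moreover have "(\<Prod>i\<in>{1..s + 1}. gauss_inner (q (\<sigma> (N + r + 2 * i - 1))) (gauss_deriv (q (\<sigma> (N + r + 2 * i))))) =
          gauss_inner (q (\<sigma> (N + r + 1))) (gauss_deriv (q (\<sigma> ?M))) * w \<sigma>"
        unfolding Suc_eq_plus1[symmetric] prod_atLeast1_Suc w_def by simp
      ultimately show "- T (N + r + 1) \<sigma> =
          sgn_form {1..N + r} (\<lambda>i. if i \<le> N then q (\<sigma> i) else gauss_deriv (q (\<sigma> i))) *
          (\<Prod>i\<in>{1..s + 1}. gauss_inner (q (\<sigma> (N + r + 2 * i - 1))) (gauss_deriv (q (\<sigma> (N + r + 2 * i)))))"
        using gauss_inner_deriv_antisym[of "q (\<sigma> ?M)" "q (\<sigma> (N + r + 1))"]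
        by (simp add: T_def g_def [abs_def])
    qed
    finally show ?thesis .
  qed
  finally show ?thesis .
qed

lemma mixed_sum_even: "mixed_sum q N (2 * k) s = fact (2 * k) / fact k * mixed_sum q N 0 (s + k)"
proof (induction k arbitrary: s)
  case 0
  show ?case by simp
next
  case (Suc k)
  have "mixed_sum q N (2 * Suc k) s = 2 * real (2 * k + 1) * mixed_sum q N (2 * k) (s + 1)"
    using mixed_sum_step[of q N "2 * k" s] by simp
  also have "\<dots> = 2 * real (2 * k + 1) * (fact (2 * k) / fact k) * mixed_sum q N 0 (s + Suc k)"
    by (simp add: Suc.IH)
  also have "2 * real (2 * k + 1) * (fact (2 * k) / fact k) = (fact (2 * Suc k) / fact (Suc k) :: real)"
    by (simp add: divide_simps) (simp add: algebra_simps)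
  finally show ?case .
qed

lemma gen_partition_fun_eq_mixed_sum:
  assumes "\<And>i. i \<ge> 1 \<Longrightarrow> degree (q i) = i - 1 \<and> lead_coeff (q i) = 1"
  shows "gen_partition_fun N k = mixed_sum q N 0 k"
proof (subst gen_partition_fun_eq_sum[where q = q])
  have "sgn_form {1..N} (\<lambda>i. if i \<le> N then q (\<sigma> i) else gauss_deriv (q (\<sigma> i))) =
      sgn_form {1..N} (\<lambda>i. q (\<sigma> i))" for \<sigma>
    by (rule sgn_form_cong) auto
  then show "(\<Sum>\<sigma> | \<sigma> permutes {1..N + 2 * k}. of_int (sign \<sigma>) *
    (sgn_form {1..N} (\<lambda>i. q (\<sigma> i)) *
      (\<Prod>i\<in>{1..k}. gauss_inner (q (\<sigma> (N + 2 * i - 1))) (gauss_deriv (q (\<sigma> (N + 2 * i))))))) =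
    mixed_sum q N 0 k"
    unfolding mixed_sum_def add_0_right by simp
qed (rule assms)

lemma sgn_form_smult:
  "finite I \<Longrightarrow> sgn_form I (\<lambda>i. smult (c i) (p i)) = (\<Prod>i\<in>I. c i) * sgn_form I p"
  unfolding sgn_form_def gauss_poly_smult prod.distrib
  by (simp only: mult.left_commute integral_mult_right_zero)

lemma card_permutes_preserving:
  "card {\<sigma>. \<sigma> permutes {1..N + r} \<and> \<sigma> ` {N + 1..N + r} = {N + 1..N + r}} = fact N * fact r"
proof -
  let ?A = "{1..N}" and ?B = "{N + 1..N + r}"
  let ?PA = "{\<alpha>. \<alpha> permutes ?A}" and ?PB = "{\<beta>. \<beta> permutes ?B}"
  let ?X = "{\<sigma>. \<sigma> permutes {1..N + r} \<and> \<sigma> ` ?B = ?B}"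
  have AB: "{1..N + r} = ?A \<union> ?B" "?A \<inter> ?B = {}" by auto
  have \<alpha>B: "(\<alpha> \<circ> \<beta>) i = \<beta> i" if "\<alpha> permutes ?A" "\<beta> permutes ?B" "i \<in> ?B" for \<alpha> \<beta> i
  proof -
    have "\<beta> i \<in> ?B" using that(3) permutes_in_image[OF that(2), of i] by simp
    then have "\<beta> i \<notin> ?A" by auto
    then show ?thesis using that by (simp add: permutes_not_in)
  qed
  have \<alpha>A: "(\<alpha> \<circ> \<beta>) i = \<alpha> i" if "\<beta> permutes ?B" "i \<notin> ?B" for \<alpha> \<beta> :: "nat \<Rightarrow> nat" and i
    using that by (simp add: permutes_not_in)
  have "bij_betw (\<lambda>(\<alpha>, \<beta>). \<alpha> \<circ> \<beta>) (?PA \<times> ?PB) ?X"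
    unfolding bij_betw_def
  proof
    show "inj_on (\<lambda>(\<alpha>, \<beta>). \<alpha> \<circ> \<beta>) (?PA \<times> ?PB)"
    proof (rule inj_onI, clarsimp simp del: comp_apply)
      fix \<alpha> \<beta> \<alpha>' \<beta>' :: "nat \<Rightarrow> nat"
      assume p: "\<alpha> permutes {Suc 0..N}" "\<beta> permutes {Suc N..N + r}"
        "\<alpha>' permutes {Suc 0..N}" "\<beta>' permutes {Suc N..N + r}" and eq: "\<alpha> \<circ> \<beta> = \<alpha>' \<circ> \<beta>'"
      have "\<beta> i = \<beta>' i" for i
        using \<alpha>B[of \<alpha> \<beta> i] \<alpha>B[of \<alpha>' \<beta>' i] p eq
        by (cases "i \<in> ?B") (auto simp: permutes_not_in)
      moreover have "\<alpha> i = \<alpha>' i" for i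
      proof (cases "i \<in> ?B")
        case True
        then have "i \<notin> {Suc 0..N}" by auto
        then show ?thesis using p by (simp add: permutes_not_in)
      next
        case False
        then show ?thesis using \<alpha>A[of \<beta> i \<alpha>] \<alpha>A[of \<beta>' i \<alpha>'] p eq by simp
      qed
      ultimately show "\<alpha> = \<alpha>' \<and> \<beta> = \<beta>'" by auto
    qed
    show "(\<lambda>(\<alpha>, \<beta>). \<alpha> \<circ> \<beta>) ` (?PA \<times> ?PB) = ?X"
    proof (intro equalityI subsetI)
      fix \<sigma> assume "\<sigma> \<in> (\<lambda>(\<alpha>, \<beta>). \<alpha> \<circ> \<beta>) ` (?PA \<times> ?PB)"
      then obtain \<alpha> \<beta> where p: "\<alpha> permutes ?A" "\<beta> permutes ?B" "\<sigma> = \<alpha> \<circ> \<beta>" by auto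
      have "\<alpha> permutes {1..N + r}" using p(1) by (rule permutes_subset) auto
      moreover have "\<beta> permutes {1..N + r}" using p(2) by (rule permutes_subset) auto
      ultimately have "\<sigma> permutes {1..N + r}" unfolding p(3) by (rule permutes_compose[rotated])
      moreover have "\<sigma> ` ?B = \<beta> ` ?B"
        unfolding p(3) using \<alpha>B[OF p(1,2)] by (rule image_cong[OF refl])
      ultimately show "\<sigma> \<in> ?X" using permutes_image[OF p(2)] by simp
    next
      fix \<sigma> assume "\<sigma> \<in> ?X"
      then have \<sigma>: "\<sigma> permutes {1..N + r}" "\<sigma> ` ?B = ?B" by auto
      have inj: "inj \<sigma>" using \<sigma>(1) by (rule permutes_inj)
      have "\<sigma> ` ?A = ?A"
      proof -
        have "?A = {1..N + r} - ?B" by auto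
        then have "\<sigma> ` ?A = \<sigma> ` {1..N + r} - \<sigma> ` ?B" using inj by (simp add: image_set_diff)
        also have "\<dots> = {1..N + r} - ?B" using \<sigma> permutes_image[OF \<sigma>(1)] by simp
        finally show ?thesis by auto
      qed
      then have bij: "bij_betw \<sigma> ?A ?A" "bij_betw \<sigma> ?B ?B"
        using \<sigma>(2) inj by (auto simp: bij_betw_def intro: inj_on_subset)
      define \<alpha> where "\<alpha> = restrict_id \<sigma> ?A"
      define \<beta> where "\<beta> = restrict_id \<sigma> ?B"
      have p: "\<alpha> permutes ?A" "\<beta> permutes ?B"
        unfolding \<alpha>_def \<beta>_def using bij by (simp_all add: permutes_restrict_id)
      have "\<sigma> i = (\<alpha> \<circ> \<beta>) i" for i
      proof (cases "i \<in> ?B")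
        case True
        then show ?thesis using \<alpha>B[OF p] by (simp add: \<beta>_def)
      next
        case False
        then have "(\<alpha> \<circ> \<beta>) i = \<alpha> i" by (rule \<alpha>A[OF p(2)])
        also have "\<dots> = \<sigma> i"
          using False \<sigma>(1) AB(1) by (cases "i \<in> ?A") (auto simp: \<alpha>_def permutes_not_in)
        finally show ?thesis ..
      qed
      then have "\<sigma> = \<alpha> \<circ> \<beta>" by auto
      then show "\<sigma> \<in> (\<lambda>(\<alpha>, \<beta>). \<alpha> \<circ> \<beta>) ` (?PA \<times> ?PB)" using p by auto
    qed
  qed
  then have "card ?X = card (?PA \<times> ?PB)" by (rule bij_betw_same_card[symmetric])
  also have "\<dots> = fact N * fact r"
    by (simp add: card_cartesian_product card_permutations)
  finally show ?thesis .
qed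

text \<open>
  If no value on the first \<open>N\<close> indices were one above a value on the last \<open>r\<close>, the latter values would be
  closed under successors below the maximum, hence be the top \<open>r\<close> values.
\<close>

lemma permutes_collision:
  fixes \<sigma> :: "nat \<Rightarrow> nat" and N r :: nat
  assumes \<sigma>: "\<sigma> permutes {1..N + r}" and not: "\<sigma> ` {N + 1..N + r} \<noteq> {N + 1..N + r}"
  obtains i j where "i \<in> {1..N}" "j \<in> {N + 1..N + r}" "\<sigma> i = \<sigma> j + 1"
proof (rule ccontr)
  assume no: "\<not> thesis"
  note hit = that
  let ?B = "{N + 1..N + r}"
  have inj: "inj \<sigma>" using \<sigma> by (rule permutes_inj)
  have card: "card (\<sigma> ` ?B) = r" using inj by (simp add: card_image inj_on_subset)
  have range: "\<sigma> i \<in> {1..N + r}" if "i \<in> {1..N + r}" for i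
    using that permutes_in_image[OF \<sigma>] by blast
  have up: "v + 1 \<in> \<sigma> ` ?B" if v: "v \<in> \<sigma> ` ?B" "v < N + r" for v
  proof -
    obtain j where j: "j \<in> ?B" "v = \<sigma> j" using v by auto
    have "v + 1 \<in> \<sigma> ` {1..N + r}" using v permutes_image[OF \<sigma>] by auto
    then obtain i where i: "i \<in> {1..N + r}" "v + 1 = \<sigma> i" by auto
    have "i \<notin> {1..N}" using no hit[of i j] i j by auto
    then show ?thesis using i by auto
  qed
  have "\<not> \<sigma> ` ?B \<subseteq> ?B"
    using card not by (metis card_subset_eq card_atLeastAtMost diff_add_inverse finite_atLeastAtMost Suc_eq_plus1 diff_Suc_Suc add_Suc_right)
  then obtain v where v: "v \<in> \<sigma> ` ?B" "v \<notin> ?B" by blast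
  then have "v \<in> {1..N + r}" using range by auto
  with v have vN: "v \<le> N" by auto
  have "{v..N + r} \<subseteq> \<sigma> ` ?B"
  proof
    fix t assume "t \<in> {v..N + r}"
    then have "v \<le> t" "t \<le> N + r" by auto
    then show "t \<in> \<sigma> ` ?B"
    proof (induction t rule: dec_induct)
      case base then show ?case using v by simp
    next
      case (step t) then show ?case using up[of t] by simp
    qed
  qed
  then have "card {v..N + r} \<le> card (\<sigma> ` ?B)" by (intro card_mono) auto
  then have "card {v..N + r} \<le> r" unfolding card .
  with vN show False by simp
qed

text \<open>
  If differentiation raises the index by one, raising \<open>2 k\<close> of the indices \<open>1, \<dots>, N + 2 k\<close> produces a repeated
  entry unless exactly the top \<open>2 k\<close> are raised. So a single configuration survives, the one in which
  the index \<open>N + 1\<close> is skipped.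
\<close>

lemma mixed_sum_raising:
  assumes raise: "\<And>i. i \<ge> 1 \<Longrightarrow> gauss_deriv (q i) = - q (i + 1)"
  shows "mixed_sum q N (2 * k) 0 =
    fact N * fact (2 * k) * sgn_form {1..N + 2 * k} (\<lambda>i. if i \<le> N then q i else q (i + 1))"
proof -
  let ?n = "N + 2 * k"
  let ?B = "{N + 1..?n}"
  define \<psi> where "\<psi> = (\<lambda>i. if i \<le> N then q i else q (i + 1))"
  let ?X = "{\<sigma>. \<sigma> permutes {1..?n} \<and> \<sigma> ` ?B = ?B}"
  have T: "sgn_form {1..?n} (\<lambda>i. if i \<le> N then q (\<sigma> i) else gauss_deriv (q (\<sigma> i))) =
      sgn_form {1..?n} (\<lambda>i. if i \<le> N then q (\<sigma> i) else q (\<sigma> i + 1))" if \<sigma>: "\<sigma> permutes {1..?n}" for \<sigma>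
  proof -
    have "sgn_form {1..?n} (\<lambda>i. if i \<le> N then q (\<sigma> i) else gauss_deriv (q (\<sigma> i))) =
        sgn_form {1..?n} (\<lambda>i. smult (if i \<le> N then 1 else - 1) (if i \<le> N then q (\<sigma> i) else q (\<sigma> i + 1)))"
    proof (rule sgn_form_cong)
      fix i assume "i \<in> {1..?n}"
      then have "\<sigma> i \<ge> 1" using permutes_in_image[OF \<sigma>, of i] by auto
      then show "(if i \<le> N then q (\<sigma> i) else gauss_deriv (q (\<sigma> i))) =
          smult (if i \<le> N then 1 else - 1) (if i \<le> N then q (\<sigma> i) else q (\<sigma> i + 1))"
        using raise by simp
    qed
    also have "(\<Prod>i\<in>{1..?n}. if i \<le> N then 1 else - 1 :: real) = 1"
      unfolding prod_atLeast1_add by simp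
    then have "sgn_form {1..?n} (\<lambda>i. smult (if i \<le> N then 1 else - 1) (if i \<le> N then q (\<sigma> i) else q (\<sigma> i + 1))) =
        sgn_form {1..?n} (\<lambda>i. if i \<le> N then q (\<sigma> i) else q (\<sigma> i + 1))"
      using sgn_form_smult[of "{1..?n}" "\<lambda>i. if i \<le> N then 1 else - 1"
        "\<lambda>i. if i \<le> N then q (\<sigma> i) else q (\<sigma> i + 1)"] by simp
    finally show ?thesis .
  qed
  have "mixed_sum q N (2 * k) 0 = (\<Sum>\<sigma> | \<sigma> permutes {1..?n}. of_int (sign \<sigma>) *
      sgn_form {1..?n} (\<lambda>i. if i \<le> N then q (\<sigma> i) else q (\<sigma> i + 1)))"
  proof (unfold mixed_sum_def mult_0_right add_0_right, rule sum.cong[OF refl])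
    fix \<sigma> assume "\<sigma> \<in> {\<sigma>. \<sigma> permutes {1..?n}}"
    then have \<sigma>: "\<sigma> permutes {1..?n}" by simp
    show "of_int (sign \<sigma>) * (sgn_form {1..?n} (\<lambda>i. if i \<le> N then q (\<sigma> i) else gauss_deriv (q (\<sigma> i))) *
        (\<Prod>i\<in>{1..0}. gauss_inner (q (\<sigma> (?n + 2 * i - 1))) (gauss_deriv (q (\<sigma> (?n + 2 * i)))))) =
      of_int (sign \<sigma>) * sgn_form {1..?n} (\<lambda>i. if i \<le> N then q (\<sigma> i) else q (\<sigma> i + 1))"
      unfolding T[OF \<sigma>] by simp
  qed
  also have "\<dots> = (\<Sum>\<sigma>\<in>?X. sgn_form {1..?n} \<psi>)"
  proof (rule sum.mono_neutral_cong_right)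
    show "\<forall>\<sigma>\<in>{\<sigma>. \<sigma> permutes {1..?n}} - ?X. of_int (sign \<sigma>) *
        sgn_form {1..?n} (\<lambda>i. if i \<le> N then q (\<sigma> i) else q (\<sigma> i + 1)) = 0"
    proof
      fix \<sigma> assume "\<sigma> \<in> {\<sigma>. \<sigma> permutes {1..?n}} - ?X"
      then obtain i j where "i \<in> {1..N}" "j \<in> ?B" "\<sigma> i = \<sigma> j + 1"
        using permutes_collision[of \<sigma> N "2 * k"] by blast
      then have "sgn_form {1..?n} (\<lambda>i. if i \<le> N then q (\<sigma> i) else q (\<sigma> i + 1)) = 0"
        by (intro sgn_form_interval_eq_0[of i _ j]) auto
      then show "of_int (sign \<sigma>) *
        sgn_form {1..?n} (\<lambda>i. if i \<le> N then q (\<sigma> i) else q (\<sigma> i + 1)) = 0" by simp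
    qed
  next
    fix \<sigma> assume "\<sigma> \<in> ?X"
    then have \<sigma>: "\<sigma> permutes {1..?n}" "\<sigma> ` ?B = ?B" by auto
    have low: "\<sigma> i \<le> N \<longleftrightarrow> i \<le> N" if i: "i \<in> {1..?n}" for i
    proof -
      have "\<sigma> i \<in> ?B \<longleftrightarrow> i \<in> ?B"
        using \<sigma> permutes_inj[OF \<sigma>(1)] by (metis inj_image_mem_iff)
      moreover have "\<sigma> i \<in> {1..?n}" using i permutes_in_image[OF \<sigma>(1)] by blast
      ultimately show ?thesis using i by auto
    qed
    have "sgn_form {1..?n} (\<lambda>i. if i \<le> N then q (\<sigma> i) else q (\<sigma> i + 1)) =
        sgn_form {1..?n} (\<lambda>i. \<psi> (\<sigma> i))"
      by (rule sgn_form_cong) (auto simp: \<psi>_def low)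
    also have "\<dots> = of_int (sign \<sigma>) * sgn_form {1..?n} \<psi>"
      by (rule sgn_form_permute[OF \<sigma>(1)])
    finally show "of_int (sign \<sigma>) *
        sgn_form {1..?n} (\<lambda>i. if i \<le> N then q (\<sigma> i) else q (\<sigma> i + 1)) = sgn_form {1..?n} \<psi>"
      by (simp add: sign_def)
  qed (auto simp: finite_permutations)
  also have "\<dots> = real (card ?X) * sgn_form {1..?n} \<psi>" by simp
  also have "card ?X = fact N * fact (2 * k)" by (rule card_permutes_preserving)
  finally show ?thesis by (simp add: \<psi>_def)
qed

section \<open>Hermite polynomials in two normalisations\<close>

text \<open>
  The probabilists' Hermite polynomials: the recursion says that differentiating
  \<open>hermite n \<cdot> exp (- x\<^sup>2 / 2)\<close> raises \<open>n\<close> by one, up to sign. They are not orthogonal for \<open>gauss_inner\<close>, whose weight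
  is \<open>exp (- x\<^sup>2)\<close>.
\<close>

fun hermite :: "nat \<Rightarrow> real poly" where
  "hermite 0 = 1"
| "hermite (Suc n) = [:0, 1:] * hermite n - pderiv (hermite n)"

lemma gauss_deriv_hermite: "gauss_deriv (hermite n) = - hermite (Suc n)"
  by (simp add: gauss_deriv_def)

lemma hermite_monic: "degree (hermite n) = n \<and> lead_coeff (hermite n) = 1"
proof (induction n)
  case 0
  show ?case by simp
next
  case (Suc n)
  then have nz: "hermite n \<noteq> 0" and deg: "degree (hermite n) = n" and lc: "coeff (hermite n) n = 1"
    by auto
  have dX: "degree ([:0, 1:] * hermite n) = Suc n"
    using nz deg by (subst degree_mult_eq) auto
  have dD: "degree (- pderiv (hermite n)) < Suc n"
    using deg by (simp add: degree_pderiv)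
  have "degree (hermite (Suc n)) = Suc n"
    using degree_add_eq_left[of "- pderiv (hermite n)" "[:0, 1:] * hermite n"] dX dD by simp
  moreover have "coeff (hermite (Suc n)) (Suc n) = 1"
    using dD lc by (simp add: coeff_eq_0 deg)
  ultimately show ?case by simp
qed

lemma pderiv_hermite: "pderiv (hermite (Suc n)) = smult (real (Suc n)) (hermite n)"
proof (induction n)
  case 0
  show ?case by (simp add: pderiv_pCons one_pCons)
next
  case (Suc n)
  have "pderiv (hermite (Suc (Suc n))) =
      hermite (Suc n) + [:0, 1:] * pderiv (hermite (Suc n)) - pderiv (pderiv (hermite (Suc n)))"
    by (simp only: hermite.simps(2)[of "Suc n"] pderiv_diff pderiv_mult) (simp add: pderiv_pCons)
  also have "\<dots> = hermite (Suc n) + smult (real (Suc n)) ([:0, 1:] * hermite n - pderiv (hermite n))"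
    unfolding Suc.IH by (simp only: pderiv_smult smult_diff_right mult_smult_right add_diff_eq)
  also have "\<dots> = smult (real (Suc (Suc n))) (hermite (Suc n))"
    by (simp only: hermite.simps(2)[of n, symmetric] of_nat_Suc[of "Suc n"] smult_add_left smult_1_left)
  finally show ?case .
qed

text \<open>
  The physicists' Hermite polynomials, scaled to be monic; these are orthogonal for \<open>gauss_inner\<close>.
\<close>

fun hermite_phys :: "nat \<Rightarrow> real poly" where
  "hermite_phys 0 = 1"
| "hermite_phys (Suc n) = [:0, 1:] * hermite_phys n - smult (1 / 2) (pderiv (hermite_phys n))"

text \<open>
  The coefficients of \<open>hermite_phys n = exp (D\<^sup>2 / 4) (hermite n)\<close>, where \<open>D\<close> is differentiation and lowers
  \<open>hermite i\<close> to \<open>i\<close> times its predecessor.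
\<close>

definition hermite_coeff :: "nat \<Rightarrow> nat \<Rightarrow> real" where
  "hermite_coeff n i = (if i \<le> n \<and> even (n - i)
    then fact n / (fact i * fact ((n - i) div 2) * 4 ^ ((n - i) div 2)) else 0)"

lemma hermite_coeff_even: "hermite_coeff (i + 2 * m) i = fact (i + 2 * m) / (fact i * fact m * 4 ^ m)"
  by (simp add: hermite_coeff_def)

lemma hermite_coeff_Suc:
  "hermite_coeff (Suc n) i =
    (if i = 0 then 0 else hermite_coeff n (i - 1)) + real (Suc i) / 2 * hermite_coeff n (Suc i)"
proof (cases "i \<le> Suc n \<and> even (Suc n - i)")
  case False
  then have "hermite_coeff (Suc n) i = 0" "hermite_coeff n (Suc i) = 0"
      "i \<noteq> 0 \<Longrightarrow> hermite_coeff n (i - 1) = 0"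
    by (auto simp: hermite_coeff_def)
  then show ?thesis by simp
next
  case True
  then obtain m where "Suc n - i = 2 * m" by (metis evenE)
  with True have n: "Suc n = i + 2 * m" by linarith
  show ?thesis
  proof (cases i)
    case 0
    then obtain m' where m: "m = Suc m'" using n by (cases m) auto
    then have n': "n = 1 + 2 * m'" using n 0 by simp
    have "hermite_coeff n 1 = fact n / (fact m' * 4 ^ m')"
      using hermite_coeff_even[of 1 m'] n' by simp
    moreover have "hermite_coeff (Suc n) 0 = fact (Suc n) / (fact m * 4 ^ m)"
      using hermite_coeff_even[of 0 m] n 0 by simp
    moreover have "fact (Suc n) / (fact m * 4 ^ m) = 1 / 2 * (fact n / (fact m' * 4 ^ m') :: real)"
    proof -
      have "fact (Suc n) = 2 * real (Suc m') * fact n" using n' by simp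
      moreover have "fact m * 4 ^ m = 4 * real (Suc m') * (fact m' * 4 ^ m')" unfolding m by simp
      ultimately show ?thesis by (simp only:) (simp add: divide_simps)
    qed
    ultimately show ?thesis using 0 by simp
  next
    case (Suc i')
    have n': "n = i' + 2 * m" using n Suc by simp
    have 1: "hermite_coeff n i' = fact n / (fact i' * fact m * 4 ^ m)"
      unfolding n' by (rule hermite_coeff_even)
    have 2: "hermite_coeff (Suc n) i = fact (Suc n) / (fact i * fact m * 4 ^ m)"
      unfolding n by (rule hermite_coeff_even)
    have 3: "real (Suc i) / 2 * hermite_coeff n (Suc i) = real (2 * m) * fact n / (fact i * fact m * 4 ^ m)"
    proof (cases m)
      case 0
      then show ?thesis using n Suc by (simp add: hermite_coeff_def)
    next
      case (Suc m')
      then have "n = Suc i + 2 * m'" using n by simp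
      then have c: "hermite_coeff n (Suc i) = fact n / (real (Suc i) * (fact i * fact m' * 4 ^ m'))"
        using hermite_coeff_even[of "Suc i" m'] by simp
      show ?thesis unfolding c Suc by (simp add: divide_simps)
    qed
    have "fact (Suc n) = real (i + 2 * m) * fact n" unfolding n[symmetric] by simp
    then have "hermite_coeff (Suc n) i =
        real i * fact n / (fact i * fact m * 4 ^ m) + real (2 * m) * fact n / (fact i * fact m * 4 ^ m)"
      unfolding 2 by (simp add: add_divide_distrib algebra_simps)
    also have "real i * fact n / (fact i * fact m * 4 ^ m) = hermite_coeff n i'"
      unfolding 1 Suc by (simp add: divide_simps)
    finally show ?thesis unfolding 3 using Suc by simp
  qed
qed

lemma pderiv_sum: "pderiv (sum f A) = (\<Sum>a\<in>A. pderiv (f a :: 'a::idom poly))"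
  by (induction A rule: infinite_finite_induct) (auto simp: pderiv_add)

lemma smult_sum_right: "smult c (sum f A) = (\<Sum>a\<in>A. smult c (f a))"
  by (induction A rule: infinite_finite_induct) (auto simp: smult_add_right)

lemma hermite_phys_expansion:
  "hermite_phys n = (\<Sum>i\<le>n. smult (hermite_coeff n i) (hermite i))"
proof (induction n)
  case 0
  show ?case by (simp add: hermite_coeff_def)
next
  case (Suc n)
  let ?c = "hermite_coeff n"
  have x: "[:0, 1:] * hermite i - smult (1 / 2) (pderiv (hermite i)) =
      hermite (Suc i) + smult (real i / 2) (hermite (i - 1))" for i
  proof (cases i)
    case (Suc i')
    have "[:0, 1:] * hermite i - smult (1 / 2) (pderiv (hermite i)) =
        hermite (Suc i) + smult (1 / 2) (pderiv (hermite i))"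
      by (simp add: poly_eq_iff field_simps)
    then show ?thesis unfolding Suc pderiv_hermite by simp
  qed (simp add: one_pCons pderiv_pCons)
  have "hermite_phys (Suc n) =
      (\<Sum>i\<le>n. smult (?c i) ([:0, 1:] * hermite i - smult (1 / 2) (pderiv (hermite i))))"
    by (simp add: Suc.IH sum_distrib_left pderiv_sum pderiv_smult smult_sum_right sum_subtractf
        smult_diff_right mult.commute)
  also have "\<dots> = (\<Sum>i\<le>n. smult (?c i) (hermite (Suc i))) +
      (\<Sum>i\<le>n. smult (real i / 2 * ?c i) (hermite (i - 1)))"
    unfolding x by (simp add: smult_add_right sum.distrib mult.commute)
  also have "(\<Sum>i\<le>n. smult (?c i) (hermite (Suc i))) =
      (\<Sum>i\<le>Suc n. smult (if i = 0 then 0 else ?c (i - 1)) (hermite i))"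
    by (simp only: sum.atMost_Suc_shift) simp
  also have "(\<Sum>i\<le>n. smult (real i / 2 * ?c i) (hermite (i - 1))) =
      (\<Sum>i\<le>Suc (Suc n). smult (real i / 2 * ?c i) (hermite (i - 1)))"
    by (simp add: hermite_coeff_def)
  also have "\<dots> = (\<Sum>i\<le>Suc n. smult (real (Suc i) / 2 * ?c (Suc i)) (hermite i))"
    by (subst sum.atMost_Suc_shift) simp
  finally show ?case
    unfolding sum.distrib[symmetric] smult_add_left[symmetric] hermite_coeff_Suc .
qed

text \<open>
  The operator that raises the degree in \<open>hermite_phys\<close> is half the adjoint of differentiation with
  respect to the weight \<open>exp (- x\<^sup>2)\<close>; iterating this gives the orthogonality.
\<close>

lemma gauss_inner_X_mult:
  "gauss_inner ([:0, 1:] * p - smult (1 / 2) (pderiv p)) w = 1 / 2 * gauss_inner p (pderiv w)"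
proof -
  have X: "gauss_inner ([:0, 1:] * p) w = gauss_inner p ([:0, 1:] * w)"
    by (simp add: gauss_inner_def gauss_poly_def mult_ac)
  have add: "gauss_inner (a - b) c = gauss_inner a c - gauss_inner b c" for a b c
    using gauss_inner_add_left[of a "- b" c] by (simp add: gauss_inner_minus_left)
  have add': "gauss_inner c (a - b) = gauss_inner c a - gauss_inner c b" for a b c
    using add[of a b c] by (simp add: gauss_inner_commute)
  have "gauss_inner (pderiv p) w - gauss_inner ([:0, 1:] * p) w =
      - (gauss_inner p (pderiv w) - gauss_inner p ([:0, 1:] * w))"
    using gauss_inner_deriv[of p w] unfolding gauss_deriv_def add add' .
  then show ?thesis unfolding add gauss_inner_smult_left X by linarith
qed

lemma hermite_phys_orthogonal: "degree w < n \<Longrightarrow> gauss_inner (hermite_phys n) w = 0"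
proof (induction n arbitrary: w)
  case 0
  then show ?case by simp
next
  case (Suc n)
  have "gauss_inner (hermite_phys n) (pderiv w) = 0"
  proof (cases "degree w = 0")
    case True
    then have "pderiv w = 0" by (simp add: pderiv_eq_0_iff)
    then show ?thesis using gauss_inner_0_left[of "hermite_phys n"] by (simp add: gauss_inner_commute)
  next
    case False
    then show ?thesis using Suc.prems by (intro Suc.IH) (simp add: degree_pderiv)
  qed
  then show ?case by (simp only: hermite_phys.simps gauss_inner_X_mult mult_zero_right)
qed

lemma gauss_inner_hermite_odd: "odd n \<Longrightarrow> gauss_inner (hermite n) 1 = 0"
proof (induction n rule: less_induct)
  case (less n)
  then obtain j where n: "n = Suc j" by (cases n) auto
  have "gauss_inner (hermite n) 1 = gauss_inner ([:0, 1:] * hermite j - smult (1 / 2) (pderiv (hermite j))) 1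
      - gauss_inner (smult (1 / 2) (pderiv (hermite j))) 1"
  proof -
    have eq: "hermite n + smult (1 / 2) (pderiv (hermite j)) =
        [:0, 1:] * hermite j - smult (1 / 2) (pderiv (hermite j))"
      unfolding n by (simp add: poly_eq_iff field_simps)
    show ?thesis
      using gauss_inner_add_left[of "hermite n" "smult (1 / 2) (pderiv (hermite j))" 1]
      unfolding eq by linarith
  qed
  also have "gauss_inner ([:0, 1:] * hermite j - smult (1 / 2) (pderiv (hermite j))) 1 = 0"
    using gauss_inner_0_left[of "hermite j"]
    by (simp only: gauss_inner_X_mult) (simp add: gauss_inner_commute)
  also have "gauss_inner (smult (1 / 2) (pderiv (hermite j))) 1 = 0"
  proof (cases j)
    case 0
    then show ?thesis by (simp add: gauss_inner_0_left)
  next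
    case (Suc i)
    then have "gauss_inner (hermite i) 1 = 0" using less n by simp
    then show ?thesis unfolding Suc pderiv_hermite by (simp add: gauss_inner_smult_left)
  qed
  finally show ?case by simp
qed

section \<open>The sign form on Hermite functions with one index skipped\<close>

text \<open>
  Every entry \<open>hermite j\<close> with \<open>j > 0\<close> is a derivative and can be contracted away. Contraction with
  \<open>hermite_phys n\<close> gives 0 by orthogonality, and contraction with another entry leaves a smaller form of
  the same kind. What remains is \<open>hermite_phys n\<close> alone or next to the constant entry, according to the
  parity of \<open>n\<close>; these forms vanish by parity.
\<close>

lemma sgn_form_hermite_phys_eq_0:
  assumes "finite I" "a \<in> I" "p a = hermite_phys n"
    and "\<forall>i\<in>I - {a}. \<exists>j\<le>n. p i = hermite j"
    and "\<forall>i\<in>I - {a}. \<forall>i'\<in>I - {a}. p i = 1 \<and> p i' = 1 \<longrightarrow> i = i'"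
    and "even (card I) \<longleftrightarrow> even n"
  shows "sgn_form I p = 0"
  using assms
proof (induction "card I" arbitrary: I rule: less_induct)
  case less
  note fin = \<open>finite I\<close> and aI = \<open>a \<in> I\<close> and pa = \<open>p a = hermite_phys n\<close>
    and vals = \<open>\<forall>i\<in>I - {a}. \<exists>j\<le>n. p i = hermite j\<close>
    and once = \<open>\<forall>i\<in>I - {a}. \<forall>i'\<in>I - {a}. p i = 1 \<and> p i' = 1 \<longrightarrow> i = i'\<close>
    and parity = \<open>even (card I) \<longleftrightarrow> even n\<close>
  show ?case
  proof (cases "\<exists>b\<in>I - {a}. \<exists>j<n. p b = hermite (Suc j)")
    case True
    then obtain b j where b: "b \<in> I" "b \<noteq> a" "j < n" "p b = hermite (Suc j)" by auto
    have pb: "p b = gauss_deriv (- hermite j)"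
      using b(4) gauss_deriv_hermite[of j] by (simp add: gauss_deriv_def pderiv_minus)
    have "gauss_inner (- hermite j) (p i) * sgn_form (I - {b, i}) p = 0" if i: "i \<in> I - {b}" for i
    proof (cases "i = a")
      case True
      have "gauss_inner (hermite_phys n) (hermite j) = 0"
        using hermite_monic[of j] b by (intro hermite_phys_orthogonal) simp
      then have "gauss_inner (hermite j) (hermite_phys n) = 0"
        unfolding gauss_inner_commute[of "hermite j"] .
      then show ?thesis using True pa by (simp add: gauss_inner_minus_left)
    next
      case False
      have "card (I - {b, i}) = card I - 2" using i b fin by (simp add: card_Diff_subset)
      moreover have "card {b, i} \<le> card I" using i b fin by (intro card_mono) auto
      ultimately have card: "card I = card (I - {b, i}) + 2" using i by simp
      have "sgn_form (I - {b, i}) p = 0"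
      proof (rule less.hyps)
        have sub: "I - {b, i} - {a} \<subseteq> I - {a}" by auto
        show "\<forall>l\<in>I - {b, i} - {a}. \<exists>j\<le>n. p l = hermite j"
          using sub vals by (meson subsetD)
        show "\<forall>l\<in>I - {b, i} - {a}. \<forall>l'\<in>I - {b, i} - {a}. p l = 1 \<and> p l' = 1 \<longrightarrow> l = l'"
          using sub once by (meson subsetD)
        show "even (card (I - {b, i})) \<longleftrightarrow> even n" using parity card by simp
      qed (use False b i fin aI pa card in auto)
      then show ?thesis by simp
    qed
    then have "(\<Sum>i\<in>I - {b}. (-1) ^ card {l\<in>I - {b}. l < i} * gauss_inner (- hermite j) (p i) *
        sgn_form (I - {b, i}) p) = 0"
      by (intro sum.neutral ballI) (simp add: mult.assoc)
    then show ?thesis by (subst sgn_form_deriv[where p = p, OF fin b(1) pb]) simp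
  next
    case False
    have ones: "p i = 1" if "i \<in> I - {a}" for i
    proof -
      obtain j where j: "j \<le> n" "p i = hermite j" using vals \<open>i \<in> I - {a}\<close> by blast
      then show ?thesis using False \<open>i \<in> I - {a}\<close> by (cases j) auto
    qed
    \<comment> \<open>Each term \<open>hermite i\<close> of \<open>hermite_phys n\<close> is in its turn a derivative, or the constant 1 if
        \<open>i = 0\<close>, which then repeats the other entry.\<close>
    have "sgn_form I (p(a := hermite_phys n)) =
        (\<Sum>i\<le>n. hermite_coeff n i * sgn_form I (p(a := hermite i)))"
      unfolding hermite_phys_expansion by (rule sgn_form_sum[OF fin aI])
    also have "\<dots> = 0"
    proof (intro sum.neutral ballI)
      fix i
      show "hermite_coeff n i * sgn_form I (p(a := hermite i)) = 0"
      proof (cases "even (n - i) \<and> i \<le> n")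
        case False
        then show ?thesis by (auto simp: hermite_coeff_def)
      next
        case i: True
        show ?thesis
        proof (cases i)
          case 0
          with i parity have "even (card I)" by simp
          then have "I \<noteq> {a}" by auto
          then obtain b where "b \<in> I" "b \<noteq> a" using aI by auto
          then have "sgn_form I (p(a := hermite i)) = 0"
            using 0 ones aI fin by (intro sgn_form_eq_0[of I a b]) auto
          then show ?thesis by simp
        next
          case (Suc j)
          let ?p = "p(a := hermite i)"
          have "?p a = gauss_deriv (- hermite j)"
            unfolding Suc using gauss_deriv_hermite[of j] by (simp add: gauss_deriv_def pderiv_minus)
          then have "sgn_form I ?p = 2 * (-1) ^ card {i\<in>I. i < a} *
            (\<Sum>b\<in>I - {a}. (-1) ^ card {i\<in>I - {a}. i < b} * gauss_inner (- hermite j) (?p b) *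
              sgn_form (I - {a, b}) ?p)"
            by (rule sgn_form_deriv[OF fin aI])
          also have "(\<Sum>b\<in>I - {a}. (-1) ^ card {i\<in>I - {a}. i < b} * gauss_inner (- hermite j) (?p b) *
              sgn_form (I - {a, b}) ?p) = 0"
          proof (intro sum.neutral ballI)
            fix b assume b: "b \<in> I - {a}"
            then have "I - {a} = {b}" using once ones by blast
            then have "I = {a, b}" using aI by auto
            then have "card I = 2" using b by auto
            then have "odd j" using parity i Suc by (auto simp: even_diff_nat)
            then have "gauss_inner (- hermite j) (?p b) = 0"
              using ones[OF b] b by (simp add: gauss_inner_minus_left gauss_inner_hermite_odd)
            then show "(-1) ^ card {i\<in>I - {a}. i < b} * gauss_inner (- hermite j) (?p b) *
              sgn_form (I - {a, b}) ?p = 0" by simp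
          qed
          finally have "sgn_form I ?p = 0" by (simp only: mult_zero_right)
          then show ?thesis by (simp only: mult_zero_right)
        qed
      qed
    qed
    finally show ?thesis using pa by (metis fun_upd_triv)
  qed
qed

text \<open>
  The cycle that removes \<open>N + 1\<close> from an increasing list and appends it at the end.
\<close>

lemma sign_cycle_to_end:
  fixes N n :: nat and c :: "nat \<Rightarrow> nat"
  assumes "N < n"
  defines "c \<equiv> \<lambda>i. if N < i \<and> i < n then i + 1 else if i = n then N + 1 else i"
  shows "c permutes {1..n}" and "of_int (sign c) = (-1 :: real) ^ (n - 1 - N)"
proof -
  have inj: "inj_on c {1..n}"
    using assms by (auto simp: inj_on_def split: if_splits)
  have "c ` {1..n} \<subseteq> {1..n}" using assms by auto
  then have "c ` {1..n} = {1..n}" by (intro endo_inj_surj inj) auto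
  with inj have "bij_betw c {1..n} {1..n}" by (simp add: bij_betw_def)
  then show perm: "c permutes {1..n}"
    using assms by (intro bij_imp_permutes) auto
  obtain m where n: "n = Suc m" using assms by (cases n) auto
  have "of_int (sign c) = (\<Prod>j\<in>{1..n}. \<Prod>i\<in>{1..<j}. sgn (real (c j) - real (c i)))"
    by (rule sign_eq_prod_sgn[OF perm])
  also have "\<dots> = (\<Prod>j\<in>{1..m}. \<Prod>i\<in>{1..<j}. sgn (real (c j) - real (c i))) *
      (\<Prod>i\<in>{1..m}. sgn (real (c n) - real (c i)))"
    unfolding n by (simp add: atLeastLessThanSuc_atLeastAtMost)
  also have "(\<Prod>j\<in>{1..m}. \<Prod>i\<in>{1..<j}. sgn (real (c j) - real (c i))) = 1"
    using assms n by (intro prod.neutral ballI) (auto simp: sgn_if split: if_splits)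
  also have "(\<Prod>i\<in>{1..m}. sgn (real (c n) - real (c i))) = (\<Prod>i\<in>{1..m}. if N < i then - 1 else 1)"
    using assms n by (intro prod.cong refl) (auto simp: sgn_if)
  also have "\<dots> = (\<Prod>i\<in>{N + 1..m}. - 1)"
    by (rule prod.mono_neutral_cong_right) auto
  also have "\<dots> = (-1) ^ (n - 1 - N)" using n by simp
  finally show "of_int (sign c) = (-1 :: real) ^ (n - 1 - N)" by simp
qed

text \<open>
  Replace the last entry \<open>hermite (N + 2 k)\<close> by \<open>hermite_phys (N + 2 k)\<close>, which annihilates the form, and
  expand in the basis \<open>hermite i\<close>. All terms repeat an entry except two: the top one is the form with a
  skipped index, and \<open>i = N\<close> fills the gap, up to a cycle of even length \<open>2 k\<close>. Hence the ratio of the two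
  forms is an expansion coefficient.
\<close>

lemma sgn_form_skip_hermite:
  fixes N k :: nat
  defines "q \<equiv> \<lambda>i. hermite (i - 1)"
  shows "sgn_form {1..N + 2 * k} (\<lambda>i. if i \<le> N then q i else q (i + 1)) =
    fact (N + 2 * k) / (fact N * fact k * 4 ^ k) * sgn_form {1..N + 2 * k} q"
proof (cases "k = 0")
  case True
  have "sgn_form {1..N} (\<lambda>i. if i \<le> N then q i else q (i + 1)) = sgn_form {1..N} q"
    by (rule sgn_form_cong) auto
  with True show ?thesis by simp
next
  case False
  let ?n = "N + 2 * k"
  define \<psi> where "\<psi> = (\<lambda>i. if i \<le> N then q i else q (i + 1))"
  have n: "?n \<in> {1..?n}" "N < ?n" using False by auto
  have \<psi>: "\<psi> i = hermite (if i \<le> N then i - 1 else i)" for i by (simp add: \<psi>_def q_def)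
  have inj: "hermite i = hermite j \<longleftrightarrow> i = j" for i j using hermite_monic by metis
  have "sgn_form {1..?n} (\<psi>(?n := hermite_phys ?n)) = 0"
  proof (rule sgn_form_hermite_phys_eq_0)
    show "\<forall>i\<in>{1..?n} - {?n}. \<exists>j\<le>?n. (\<psi>(?n := hermite_phys ?n)) i = hermite j"
    proof
      fix i assume "i \<in> {1..?n} - {?n}"
      then show "\<exists>j\<le>?n. (\<psi>(?n := hermite_phys ?n)) i = hermite j"
        by (intro exI[of _ "if i \<le> N then i - 1 else i"]) (auto simp: \<psi>)
    qed
    show "\<forall>i\<in>{1..?n} - {?n}. \<forall>i'\<in>{1..?n} - {?n}.
        (\<psi>(?n := hermite_phys ?n)) i = 1 \<and> (\<psi>(?n := hermite_phys ?n)) i' = 1 \<longrightarrow> i = i'"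
      unfolding hermite.simps(1)[symmetric] by (auto simp: \<psi> inj simp del: hermite.simps split: if_splits)
  qed (use n in auto)
  also have "sgn_form {1..?n} (\<psi>(?n := hermite_phys ?n)) =
      (\<Sum>i\<le>?n. hermite_coeff ?n i * sgn_form {1..?n} (\<psi>(?n := hermite i)))"
    unfolding hermite_phys_expansion using n by (intro sgn_form_sum) auto
  also have "\<dots> = (\<Sum>i\<in>{N, ?n}. hermite_coeff ?n i * sgn_form {1..?n} (\<psi>(?n := hermite i)))"
  proof (rule sum.mono_neutral_right)
    show "\<forall>i\<in>{..?n} - {N, ?n}. hermite_coeff ?n i * sgn_form {1..?n} (\<psi>(?n := hermite i)) = 0"
    proof
      fix i assume i: "i \<in> {..?n} - {N, ?n}"
      define b where "b = (if i < N then i + 1 else i)"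
      have "b \<in> {1..?n}" "b \<noteq> ?n" "\<psi> b = hermite i"
        using i n by (auto simp: b_def \<psi>)
      then have "sgn_form {1..?n} (\<psi>(?n := hermite i)) = 0"
        using n by (intro sgn_form_interval_eq_0[of ?n _ b]) auto
      then show "hermite_coeff ?n i * sgn_form {1..?n} (\<psi>(?n := hermite i)) = 0" by simp
    qed
  qed auto
  also have "\<dots> = hermite_coeff ?n N * sgn_form {1..?n} (\<psi>(?n := hermite N)) +
      hermite_coeff ?n ?n * sgn_form {1..?n} (\<psi>(?n := hermite ?n))"
    using n by simp
  also have "hermite_coeff ?n ?n = 1" by (simp add: hermite_coeff_def)
  also have "\<psi>(?n := hermite ?n) = \<psi>" using n by (auto simp: \<psi>)
  also have "hermite_coeff ?n N = fact ?n / (fact N * fact k * 4 ^ k)"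
    by (rule hermite_coeff_even)
  also have "sgn_form {1..?n} (\<psi>(?n := hermite N)) = - sgn_form {1..?n} q"
  proof -
    define c where "c = (\<lambda>i. if N < i \<and> i < ?n then i + 1 else if i = ?n then N + 1 else i)"
    have c: "c permutes {1..?n}" "of_int (sign c) = (-1 :: real) ^ (?n - 1 - N)"
      unfolding c_def using sign_cycle_to_end[OF n(2)] by auto
    have "odd (?n - 1 - N)" using False by simp
    then have "sgn_form {1..?n} (\<lambda>i. q (c i)) = - sgn_form {1..?n} q"
      using sgn_form_permute[OF c(1), of q] c(2) by simp
    moreover have "sgn_form {1..?n} (\<psi>(?n := hermite N)) = sgn_form {1..?n} (\<lambda>i. q (c i))"
      by (rule sgn_form_cong) (auto simp: \<psi> q_def c_def)
    ultimately show ?thesis by simp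
  qed
  finally show ?thesis by (simp add: \<psi>_def)
qed

theorem lemma1:
  fixes n k :: nat
  assumes "n > 0" and "k > 0" and "n \<ge> 2 * k"
  shows "gen_partition_fun (n - 2 * k) k = 2 powi (- 2 * int k) * partition_fun n"
proof -
  define q where "q = (\<lambda>i. hermite (i - 1))"
  have monic: "degree (q i) = i - 1 \<and> lead_coeff (q i) = 1" if "i \<ge> 1" for i
    unfolding q_def by (rule hermite_monic)
  have raise: "gauss_deriv (q i) = - q (i + 1)" if "i \<ge> 1" for i
    using that gauss_deriv_hermite[of "i - 1"] by (simp add: q_def)
  \<comment> \<open>Evaluate the sum with \<open>2 l\<close> derivatives twice: by contracting pairs and by raising indices.\<close>
  have G: "gen_partition_fun N l = fact l * fact N * (fact (N + 2 * l) / (fact N * fact l * 4 ^ l)) *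
      sgn_form {1..N + 2 * l} q" for N l
  proof -
    have "gen_partition_fun N l = mixed_sum q N 0 l"
      by (rule gen_partition_fun_eq_mixed_sum) (rule monic)
    then have "fact (2 * l) / fact l * gen_partition_fun N l = mixed_sum q N (2 * l) 0"
      using mixed_sum_even[of q N l 0] by simp
    also have "\<dots> = fact N * fact (2 * l) * (fact (N + 2 * l) / (fact N * fact l * 4 ^ l) *
        sgn_form {1..N + 2 * l} q)"
    proof -
      have "sgn_form {1..N + 2 * l} (\<lambda>i. if i \<le> N then q i else q (i + 1)) =
          fact (N + 2 * l) / (fact N * fact l * 4 ^ l) * sgn_form {1..N + 2 * l} q"
        unfolding q_def by (rule sgn_form_skip_hermite)
      then show ?thesis by (subst mixed_sum_raising) (simp_all only: raise)
    qed
    finally show ?thesis by (simp add: field_simps)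
  qed
  have "gen_partition_fun (n - 2 * k) k = fact n / 4 ^ k * sgn_form {1..n} q"
    using G[of "n - 2 * k" k] assms by simp
  moreover have "partition_fun n = fact n * sgn_form {1..n} q"
    using G[of n 0] by (simp add: partition_fun_def)
  moreover have "2 powi (- 2 * int k) = (1 / 4 ^ k :: real)"
  proof -
    have "2 powi (- 2 * int k) = inverse ((2::real) ^ (2 * k))"
      by (simp add: power_int_def nat_mult_distrib power_one_over inverse_eq_divide)
    then show ?thesis by (simp add: power_mult divide_inverse)
  qed
  ultimately show ?thesis by simp
qed

end
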